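(* Let $1<\alpha<2$. Then the Hilbert matrix operator satisfies $$\|\mathcal H\|_{\mathcal B^\alpha\to\mathcal B^\alpha_{\log}}=\begin{cases}\dfrac32, & 1<\alpha\le\dfrac43,\\[8pt] C_\alpha+\dfrac{\sqrt\pi\,\Gamma(2-\alpha)}{4\,\Gamma(5/2-\alpha)}, & \dfrac43<\alpha<2.\end{cases}$$ At $\alpha=4/3$ the two expressions agree. The norm-attaining functions of norm one (i.e. the $f\in\mathcal B^\alpha$ with $\|f\|_{\mathcal B^\alpha}=1$ and $\|\mathcal Hf\|_{\mathcal B^\alpha_{\log}}=\|\mathcal H\|_{\mathcal B^\alpha\to\mathcal B^\alpha_{\log}}$) are precisely the following functions, where $\lambda$ ranges over $\mathbb T$: - if $1<\alpha<4/3$: $f(z)=\lambda$; - if $\alpha=4/3$: $f(z)=\lambda\bigl(a+(1-a)F_{4/3}(z)\bigr)$ with $0\le a\le 1$; - if $4/3<\alpha<2$: $f(z)=\lambda F_\alpha(z)$.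
   Context: Let $\mathbb D=\{z\in\mathbb C:|z|<1\}$ and $\mathbb T=\{\lambda\in\mathbb C:|\lambda|=1\}$. For $\alpha>0$, the $\alpha$-Bloch space $\mathcal B^\alpha$ consists of all analytic functions $f$ on $\mathbb D$ with $$\|f\|_{\mathcal B^\alpha}=|f(0)|+\sup_{z\in\mathbb D}(1-|z|^2)^\alpha|f'(z)|<\infty.$$ Let $L(r)=\log\frac{e}{(1-r)^2}=1-2\log(1-r)$ for $0\le r<1$. The logarithmically weighted $\alpha$-Bloch space $\mathcal B^\alpha_{\log}$ consists of all analytic functions $f$ on $\mathbb D$ with $$\|f\|_{\mathcal B^\alpha_{\log}}=|f(0)|+\sup_{z\in\mathbb D}\frac{(1-|z|^2)^\alpha}{L(|z|)}|f'(z)|<\infty.$$ The Hilbert matrix operator is defined by $$\mathcal Hf(z)=\int_0^1\frac{f(t)}{1-tz}\,dt,\qquad z\in\mathbb D.$$ For $1<\alpha<2$, set $$C_\alpha=\int_0^1(1-t)(1-t^2)^{-\alpha}\,dt,\qquad F_\alpha(z)=\int_0^z(1-\zeta^2)^{-\alpha}\,d\zeta\quad(z\in\mathbb D),$$ where $(1-z^2)^{-\alpha}$ denotes the analytic branch on $\mathbb D$ which is positive on $[0,1)$. $\Gamma$ is the Gamma function. $\|\mathcal H\|_{\mathcal B^\alpha\to\mathcal B^\alpha_{\log}}$ is the operator norm. *)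

theory Defs
  imports "HOL-Complex_Analysis.Complex_Analysis"
begin

text \<open>
  Functions on the open unit disc are modelled by total functions \<open>complex \<Rightarrow> complex\<close> of which
  only the restriction to \<open>ball 0 1\<close> matters. The real-valued suprema below are
  meaningful only when the family in question is bounded; this is part of membership in
  the two spaces.
\<close>

definition bloch :: "real \<Rightarrow> (complex \<Rightarrow> complex) set" where
  "bloch \<alpha> = {f. f holomorphic_on ball 0 1 \<and>
     bdd_above ((\<lambda>z. (1 - (norm z)\<^sup>2) powr \<alpha> * norm (deriv f z)) ` ball 0 1)}"

definition bloch_norm :: "real \<Rightarrow> (complex \<Rightarrow> complex) \<Rightarrow> real" where
  "bloch_norm \<alpha> f =
     norm (f 0) + (SUP z\<in>ball 0 1. (1 - (norm z)\<^sup>2) powr \<alpha> * norm (deriv f z))"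

definition L :: "real \<Rightarrow> real" where
  "L r = ln (exp 1 / (1 - r)\<^sup>2)"

definition log_bloch :: "real \<Rightarrow> (complex \<Rightarrow> complex) set" where
  "log_bloch \<alpha> = {f. f holomorphic_on ball 0 1 \<and>
     bdd_above ((\<lambda>z. (1 - (norm z)\<^sup>2) powr \<alpha> / L (norm z) * norm (deriv f z)) ` ball 0 1)}"

definition log_bloch_norm :: "real \<Rightarrow> (complex \<Rightarrow> complex) \<Rightarrow> real" where
  "log_bloch_norm \<alpha> f =
     norm (f 0) + (SUP z\<in>ball 0 1. (1 - (norm z)\<^sup>2) powr \<alpha> / L (norm z) * norm (deriv f z))"

text \<open>The endpoint \<open>t = 1\<close> is left out, so that \<open>f\<close> is evaluated only inside the disc.\<close>

definition hilbert_op :: "(complex \<Rightarrow> complex) \<Rightarrow> complex \<Rightarrow> complex" where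
  "hilbert_op f z = (LINT t:{0..<1}|lborel. f (of_real t) / (1 - of_real t * z))"

text \<open>
  As a supremum of reals this is the operator norm only if the operator is bounded, which has
  to be asserted separately.
\<close>

definition hilbert_op_norm :: "real \<Rightarrow> real" where
  "hilbert_op_norm \<alpha> = (SUP f\<in>{f \<in> bloch \<alpha>. bloch_norm \<alpha> f \<le> 1}. log_bloch_norm \<alpha> (hilbert_op f))"

definition norm_attaining :: "real \<Rightarrow> (complex \<Rightarrow> complex) set" where
  "norm_attaining \<alpha> = {f \<in> bloch \<alpha>. bloch_norm \<alpha> f = 1 \<and>
     log_bloch_norm \<alpha> (hilbert_op f) = hilbert_op_norm \<alpha>}"

definition C :: "real \<Rightarrow> real" where
  "C \<alpha> = (LINT t:{0..<1}|lborel. (1 - t) * (1 - t\<^sup>2) powr (-\<alpha>))"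

text \<open>
  For \<open>\<zeta>\<close> in the disc, \<open>1 - \<zeta>\<^sup>2\<close> has positive real part, so the principal power is the analytic
  branch that is positive on \<open>[0,1)\<close>.
\<close>

definition F :: "real \<Rightarrow> complex \<Rightarrow> complex" where
  "F \<alpha> z = contour_integral (linepath 0 z) (\<lambda>\<zeta>. (1 - \<zeta>\<^sup>2) powr (- of_real \<alpha>))"

end

theory Submission
  imports Defs
begin

text \<open>
  Write \<open>a = |f 0|\<close> and let \<open>b\<close> be the Bloch seminorm of \<open>f\<close>. Integrating \<open>f'\<close> along a radius gives
  \<open>|f t| \<le> a + b F(t)\<close> on \<open>[0,1)\<close>, where on the real segment \<open>F = F \<alpha>\<close> is the \<open>majorant\<close>. Everything that
  is to be estimated is a positive integral of \<open>|f|\<close> over \<open>[0,1)\<close>: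
  \<open>|Hf(0)| \<le> a + b C\<close>, and for \<open>|z| = r\<close> the weighted derivative of \<open>Hf\<close> is at most
  \<open>a A(r) + b B(r)\<close>, where \<open>A(r)\<close> and \<open>B(r)\<close> are \<open>(1 - r\<^sup>2)\<^sup>\<alpha> / L(r)\<close> times the integrals of
  \<open>t / (1 - t r)\<^sup>2\<close> and of \<open>t F(t) / (1 - t r)\<^sup>2\<close>. If both functions are largest at \<open>r = 0\<close>, the norm of
  \<open>Hf\<close> is at most \<open>a (3/2) + b (C + B(0))\<close>, with equality for \<open>f = \<lambda> (a + b F)\<close>. So the operator norm is
  the larger of \<open>3/2\<close> and \<open>C + B(0)\<close>. The second number (\<open>F_image_norm\<close>) is strictly increasing in
  \<open>\<alpha>\<close>, because its integrand is, and it equals \<open>3/2\<close> at \<open>\<alpha> = 4/3\<close>, where the integrand has an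
  elementary antiderivative. Equality in \<open>|Hf(0)| \<le> a + b C\<close> forces \<open>f = \<lambda> (a + b F)\<close> on \<open>[0,1)\<close>, hence on
  the disc by the identity theorem; this determines the norm-attaining functions.

  The work lies in the bounds for \<open>A\<close> and \<open>B\<close>. From \<open>1 - t r = (1 - t\<^sup>2 r\<^sup>2) / (1 + t r)\<close> and
  \<open>1 + t r \<le> 1 + r\<close> one gets \<open>A(r) \<le> (1 + r)\<^sup>2 / (2 L(r)) \<le> 1/2 = A(0)\<close>. For \<open>B\<close>, integration by parts against
  \<open>F\<close> and the substitution \<open>t = s / sqrt Y\<close> with \<open>Y = 1 - r\<^sup>2 (1 - s\<^sup>2)\<close> turn the same step into
  \<open>B(r) \<le> (1 + r)\<^sup>2 / (2 L(r))\<close> times the integral of \<open>(1 - s\<^sup>2)\<^sup>1\<^sup>-\<^sup>\<alpha> Y\<^sup>\<alpha>\<^sup>-\<^sup>3\<^sup>/\<^sup>2\<close>. For \<open>\<alpha> \<ge> 3/2\<close> the last factor is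
  at most \<open>1\<close> and \<open>B(r) \<le> B(0)\<close> follows at once. For \<open>4/3 \<le> \<alpha> \<le> 3/2\<close> the factor exceeds \<open>1\<close>, but
  moderately in the mean; this is compensated by \<open>(1 + t r)\<^sup>2 \<le> (1 + r) (1 + t\<^sup>2 r)\<close>, which saves a term of order \<open>r\<close>, and the
  mean of the factor is at most a quadratic polynomial in \<open>r\<^sup>2\<close>.

  For \<open>\<alpha>\<close> close to \<open>1\<close> the inequality \<open>B(r) \<le> B(0)\<close> fails for some \<open>r\<close>. There only
  \<open>C + B(r) < 3/2\<close> is needed, uniformly in \<open>r\<close>, and this follows because \<open>C\<close> and \<open>B(r)\<close> are convex in \<open>\<alpha>\<close>: at
  \<open>\<alpha> = 4/3\<close> the sum is at most \<open>3/2\<close>, and at \<open>\<alpha> = 1\<close> it is at most \<open>ln 2 + 3/4\<close>.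
\<close>

section \<open>The radial majorant\<close>

text \<open>The restriction of \<open>F \<alpha>\<close> to \<open>[0,1)\<close>. It is kept real so that it can be compared and
  integrated as a positive function.\<close>

definition majorant :: "real \<Rightarrow> real \<Rightarrow> real" where
  "majorant \<alpha> t = integral {0..t} (\<lambda>s. (1 - s\<^sup>2) powr (-\<alpha>))"

lemma weight_pos: "0 \<le> t \<Longrightarrow> t < 1 \<Longrightarrow> 0 < 1 - (t::real)\<^sup>2"
  by (simp add: power_less_one_iff abs_square_less_1)

lemma continuous_weight: "continuous_on {0..<1} (\<lambda>t::real. (1 - t\<^sup>2) powr a)"
  by (intro continuous_intros) (use weight_pos in force)

lemma majorant_0 [simp]: "majorant \<alpha> 0 = 0"
  by (simp add: majorant_def)

lemma majorant_nonneg: "0 \<le> majorant \<alpha> t"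
  unfolding majorant_def by (cases "(\<lambda>s. (1 - s\<^sup>2) powr (-\<alpha>)) integrable_on {0..t}")
    (auto intro: integral_nonneg simp: not_integrable_integral)

lemma weight_integrable_initial:
  assumes "t < 1"
  shows "(\<lambda>s::real. (1 - s\<^sup>2) powr a) integrable_on {0..t}"
  by (rule integrable_continuous_real)
     (rule continuous_on_subset[OF continuous_weight], use assms in auto)

lemma majorant_has_derivative:
  assumes "0 < t" "t < 1"
  shows "(majorant \<alpha> has_real_derivative (1 - t\<^sup>2) powr (-\<alpha>)) (at t)"
proof -
  define c where "c = (1 + t) / 2"
  have c: "t < c" "c < 1" using assms by (auto simp: c_def)
  have "((\<lambda>u. integral {0..u} (\<lambda>s. (1 - s\<^sup>2) powr (-\<alpha>))) has_real_derivative (1 - t\<^sup>2) powr (-\<alpha>))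
        (at t within {0..c})"
    by (rule integral_has_real_derivative)
       (use assms c in \<open>auto intro: continuous_on_subset[OF continuous_weight]\<close>)
  moreover have "at t within {0..c} = at t"
    using assms c by (simp add: at_within_Icc_at)
  ultimately show ?thesis by (simp add: majorant_def[abs_def])
qed

lemma continuous_majorant: "continuous_on {0..<1} (majorant \<alpha>)"
proof -
  have "isCont (majorant \<alpha>) t" if "0 < t" "t < 1" for t
    using majorant_has_derivative[OF that] by (rule DERIV_isCont)
  moreover have "continuous (at 0 within {0..<1}) (majorant \<alpha>)"
  proof -
    have "continuous_on {0..1/2} (majorant \<alpha>)"
      unfolding majorant_def[abs_def]
      by (rule indefinite_integral_continuous_1) (rule weight_integrable_initial, simp)
    hence "continuous (at 0 within {0..1/2}) (majorant \<alpha>)"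
      by (simp add: continuous_on_eq_continuous_within)
    moreover have "at (0::real) within {0..1/2} = at 0 within {0..<1}"
      by (rule at_within_nhd[of _ "{-1<..<1/2}"]) auto
    ultimately show ?thesis by simp
  qed
  ultimately show ?thesis
    unfolding continuous_on_eq_continuous_within
    by (metis atLeastLessThan_iff continuous_at_imp_continuous_at_within less_eq_real_def)
qed

text \<open>The true growth for \<open>\<alpha> > 1\<close> is \<open>(1 - t)\<^sup>1\<^sup>-\<^sup>\<alpha>\<close>, and it is logarithmic for \<open>\<alpha> = 1\<close>. Raising the exponent
  of the integrand from \<open>\<alpha>\<close> to \<open>\<alpha>/2 + 1\<close> covers both cases at once; the resulting bound is still integrable
  and makes \<open>(1 - t) majorant \<alpha> t\<close> tend to \<open>0\<close> at \<open>1\<close>.\<close>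
lemma majorant_le:
  assumes "1 \<le> \<alpha>" "\<alpha> < 2" "0 \<le> t" "t < 1"
  shows "majorant \<alpha> t \<le> 2 * (1 - t) powr (-\<alpha>/2)"
proof -
  let ?G = "\<lambda>s::real. (2/\<alpha>) * (1 - s) powr (-\<alpha>/2)"
  have "((\<lambda>s. (1 - s) powr (-\<alpha>/2 - 1)) has_integral ?G t - ?G 0) {0..t}"
    by (rule fundamental_theorem_of_calculus)
       (use assms in \<open>auto intro!: derivative_eq_intros simp flip: has_real_derivative_iff_has_vector_derivative\<close>)
  moreover have "((\<lambda>s. (1 - s\<^sup>2) powr (-\<alpha>)) has_integral majorant \<alpha> t) {0..t}"
    unfolding majorant_def using weight_integrable_initial[OF assms(4)] by (rule integrable_integral)
  moreover have "(1 - s\<^sup>2) powr (-\<alpha>) \<le> (1 - s) powr (-\<alpha>/2 - 1)" if "s \<in> {0..t}" for s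
  proof -
    have s: "0 < 1 - s" "0 \<le> s" "1 - s \<le> 1 - s\<^sup>2"
      using that assms by (auto simp: power2_eq_square mult_left_le_one_le)
    have "(1 - s\<^sup>2) powr (-\<alpha>) \<le> (1 - s) powr (-\<alpha>)"
      using s assms by (intro powr_mono2') auto
    also have "\<dots> \<le> (1 - s) powr (-\<alpha>/2 - 1)"
      using s assms by (intro powr_mono') auto
    finally show ?thesis .
  qed
  ultimately have "majorant \<alpha> t \<le> ?G t - ?G 0" by (blast intro: has_integral_le)
  also have "\<dots> \<le> ?G t" using assms by simp
  also have "\<dots> \<le> 2 * (1 - t) powr (-\<alpha>/2)"
    using assms by (intro mult_right_mono) (auto simp: field_simps)
  finally show ?thesis .
qed

lemma weight_integrable:
  assumes "0 < \<beta>"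
  shows "(\<lambda>t::real. (1 - t\<^sup>2) powr (\<beta> - 1)) integrable_on {0..1}"
proof (cases "\<beta> \<le> 1")
  case True
  show ?thesis
  proof (rule measurable_bounded_by_integrable_imp_integrable_real)
    show "(\<lambda>t::real. (1 - t) powr (\<beta> - 1)) integrable_on {0..1}"
      by (rule integrable_spike_finite[where S = "{0}", OF _ _ integrable_Beta'[of 1 \<beta>]])
         (use assms in auto)
    show "\<bar>(1 - t\<^sup>2) powr (\<beta> - 1)\<bar> \<le> (1 - t) powr (\<beta> - 1)" if "t \<in> {0..1}" for t :: real
    proof (cases "t = 1")
      case False
      thus ?thesis using that True
        by (auto intro!: powr_mono2' simp: power2_eq_square mult_left_le_one_le)
    qed auto
  qed (auto intro!: measurable_restrict_space1 measurable_completion)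
next
  case False
  thus ?thesis
    by (intro integrable_continuous_real continuous_on_powr' continuous_intros)
       (auto simp: power_le_one_iff abs_square_le_1)
qed

lemma majorant_decay:
  assumes "1 \<le> \<alpha>" "\<alpha> < 2" and "\<And>t. t \<in> {0..1} \<Longrightarrow> \<bar>k t\<bar> \<le> M * (1 - t)"
    and "continuous_on {0..1} k"
  shows "continuous_on {0..1} (\<lambda>t. k t * majorant \<alpha> t)"
proof -
  have "continuous (at 1 within {0..1}) (\<lambda>t. k t * majorant \<alpha> t)"
  proof -
    have k1: "k 1 = 0" using assms(3)[of 1] by simp
    have "((\<lambda>t. M * (2 * (1 - t) powr (1 - \<alpha>/2))) \<longlongrightarrow> M * (2 * (1 - 1) powr (1 - \<alpha>/2))) (at 1 within {0..1})"
      using assms(2) by (intro tendsto_intros tendsto_powr') (auto simp: eventually_at_filter)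
    hence lim: "((\<lambda>t. M * (2 * (1 - t) powr (1 - \<alpha>/2))) \<longlongrightarrow> 0) (at 1 within {0..1})"
      using assms(2) by simp
    have bnd: "norm (k t * majorant \<alpha> t) \<le> M * (2 * (1 - t) powr (1 - \<alpha>/2))" if "t \<in> {0..1}" "t \<noteq> 1" for t
    proof -
      have "norm (k t * majorant \<alpha> t) = \<bar>k t\<bar> * majorant \<alpha> t"
        by (simp add: abs_mult majorant_nonneg)
      also have "\<dots> \<le> (M * (1 - t)) * (2 * (1 - t) powr (-\<alpha>/2))"
        using that assms by (intro mult_mono majorant_le) (auto simp: majorant_nonneg intro: order_trans[OF abs_ge_zero])
      also have "\<dots> = M * (2 * (1 - t) powr (1 - \<alpha>/2))"
      proof -
        have "(1 - t) powr 1 * (1 - t) powr (-\<alpha>/2) = (1 - t) powr (1 + (-\<alpha>/2))"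
          by (rule powr_add[symmetric])
        thus ?thesis using that by simp
      qed
      finally show ?thesis .
    qed
    have "((\<lambda>t. k t * majorant \<alpha> t) \<longlongrightarrow> 0) (at 1 within {0..1})"
      by (rule Lim_null_comparison[OF _ lim]) (use bnd in \<open>auto simp: eventually_at_filter\<close>)
    thus ?thesis by (simp add: continuous_within k1)
  qed
  moreover have "continuous (at t within {0..1}) (\<lambda>t. k t * majorant \<alpha> t)" if "t \<in> {0..<1}" for t
  proof -
    have "continuous_on {0..<1} (\<lambda>t. k t * majorant \<alpha> t)"
      by (intro continuous_intros continuous_majorant continuous_on_subset[OF assms(4)]) auto
    hence "continuous (at t within {0..<1}) (\<lambda>t. k t * majorant \<alpha> t)"
      using that by (simp add: continuous_on_eq_continuous_within)
    moreover have "at t within {0..<1} = at t within {0..1}"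
      by (rule at_within_nhd[of _ "{..<1}"]) (use that in auto)
    ultimately show ?thesis by simp
  qed
  ultimately show ?thesis
    unfolding continuous_on_eq_continuous_within
    by (metis atLeastAtMost_iff atLeastLessThan_iff less_eq_real_def)
qed

text \<open>The fundamental theorem needs the antiderivative \<open>k * majorant \<alpha>\<close> to be continuous on the closed
  interval only; a factor \<open>k\<close> that vanishes to first order at \<open>1\<close> achieves this although the
  majorant is unbounded.\<close>
lemma majorant_by_parts:
  assumes "1 \<le> \<alpha>" "\<alpha> < 2" and "\<And>t. t \<in> {0..1} \<Longrightarrow> \<bar>k t\<bar> \<le> M * (1 - t)"
    and "continuous_on {0..1} k"
    and "\<And>t. t \<in> {0<..<1} \<Longrightarrow> (k has_real_derivative - k' t) (at t)"
    and "((\<lambda>t. k t * (1 - t\<^sup>2) powr (-\<alpha>)) has_integral I) {0..1}"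
  shows "((\<lambda>t. k' t * majorant \<alpha> t) has_integral I) {0..1}"
proof -
  have k1: "k 1 = 0" using assms(3)[of 1] by simp
  have "((\<lambda>t. k t * (1 - t\<^sup>2) powr (-\<alpha>) - k' t * majorant \<alpha> t) has_integral
          k 1 * majorant \<alpha> 1 - k 0 * majorant \<alpha> 0) {0..1}"
    by (rule fundamental_theorem_of_calculus_interior)
       (use assms in \<open>auto intro!: majorant_decay[where M = M] derivative_eq_intros majorant_has_derivative
           simp flip: has_real_derivative_iff_has_vector_derivative\<close>)
  from has_integral_diff[OF assms(6) this] show ?thesis by (simp add: k1)
qed

text \<open>The integrand may be unbounded at both endpoints, because its indefinite integral, which is
  continuous up to the endpoints, is what gets composed with \<open>g\<close>.\<close>
lemma has_integral_substitution_unit: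
  fixes f g g' :: "real \<Rightarrow> real"
  assumes f: "(f has_integral I) {0..1}" "continuous_on {0<..<1} f"
    and g: "continuous_on {0..1} g" "g 0 = 0" "g 1 = 1"
    and g': "\<And>t. t \<in> {0<..<1} \<Longrightarrow> (g has_real_derivative g' t) (at t)"
            "\<And>t. t \<in> {0<..<1} \<Longrightarrow> g t \<in> {0<..<1}"
  shows "((\<lambda>t. f (g t) * g' t) has_integral I) {0..1}"
proof -
  define G where "G = (\<lambda>x. integral {0..x} f)"
  have int: "f integrable_on {0..1}" using f by blast
  have G1: "(G has_real_derivative f x) (at x)" if "x \<in> {0<..<1}" for x
  proof -
    have "continuous (at x within {0..1} - {}) f"
      using f(2) that by (simp add: at_within_Icc_at continuous_on_eq_continuous_at)
    from integral_has_vector_derivative_continuous_at[OF int _ _ this] that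
    show ?thesis by (simp add: G_def at_within_Icc_at has_real_derivative_iff_has_vector_derivative)
  qed
  have gim: "g t \<in> {0..1}" if "t \<in> {0..1}" for t
    using g'(2)[of t] g that by (cases "t = 0 \<or> t = 1") auto
  have "((\<lambda>t. f (g t) * g' t) has_integral (G (g 1) - G (g 0))) {0..1}"
  proof (rule fundamental_theorem_of_calculus_interior)
    have "continuous_on {0..1} G"
      unfolding G_def by (rule indefinite_integral_continuous_1[OF int])
    thus "continuous_on {0..1} (\<lambda>t. G (g t))"
      by (rule continuous_on_compose2[OF _ g(1)]) (use gim in blast)
    fix t :: real assume "t \<in> {0<..<1}"
    thus "((\<lambda>t. G (g t)) has_vector_derivative f (g t) * g' t) (at t)"
      unfolding has_real_derivative_iff_has_vector_derivative[symmetric]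
      by (intro DERIV_chain2 G1 g')
  qed auto
  thus ?thesis using f(1) by (simp add: g G_def integral_unique)
qed

section \<open>Integrals of the majorant\<close>


lemma weight_times_integrable:
  fixes g :: "real \<Rightarrow> real"
  assumes "0 < \<beta>" "continuous_on {0..1} g"
  shows "(\<lambda>t. g t * (1 - t\<^sup>2) powr (\<beta> - 1)) integrable_on {0..1}"
proof -
  have "(\<lambda>t. g t * (1 - t\<^sup>2) powr (\<beta> - 1)) absolutely_integrable_on {0..1}"
  proof (rule absolutely_integrable_bounded_measurable_product_real)
    show "g \<in> borel_measurable (lebesgue_on {0..1})"
      using assms by (intro continuous_imp_measurable_on_sets_lebesgue) auto
    show "bounded (g ` {0..1})"
      using assms by (intro compact_imp_bounded compact_continuous_image) auto
    show "(\<lambda>t. (1 - t\<^sup>2) powr (\<beta> - 1)) absolutely_integrable_on {0..1}"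
      by (intro nonnegative_absolutely_integrable_1 weight_integrable assms) auto
  qed auto
  thus ?thesis by (simp add: set_lebesgue_integral_eq_integral)
qed

lemma majorant_integrable:
  assumes "1 \<le> \<alpha>" "\<alpha> < 2"
  shows "majorant \<alpha> integrable_on {0..1}"
proof -
  have "(\<lambda>t. 1 / (1 + t) * (1 - t\<^sup>2) powr ((2 - \<alpha>) - 1)) integrable_on {0..1::real}"
    by (rule weight_times_integrable) (use assms in \<open>auto intro!: continuous_intros\<close>)
  hence "(\<lambda>t. (1 - t) * (1 - t\<^sup>2) powr (-\<alpha>)) integrable_on {0..1::real}"
  proof (rule integrable_spike_finite[where S = "{1}", rotated 2])
    fix t :: real assume "t \<in> {0..1} - {1}"
    hence t: "0 < 1 - t\<^sup>2" "1 + t \<noteq> 0" using weight_pos[of t] by auto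
    have "(1 - t\<^sup>2) powr (2 - \<alpha> - 1) = (1 - t\<^sup>2) powr (1 + (-\<alpha>))" by simp
    also have "\<dots> = (1 - t\<^sup>2) powr 1 * (1 - t\<^sup>2) powr (-\<alpha>)" by (rule powr_add)
    also have "\<dots> = (1 + t) * ((1 - t) * (1 - t\<^sup>2) powr (-\<alpha>))"
      using t by (simp add: power2_eq_square algebra_simps)
    finally show "(1 - t) * (1 - t\<^sup>2) powr (-\<alpha>) = 1 / (1 + t) * (1 - t\<^sup>2) powr (2 - \<alpha> - 1)"
      using t by simp
  qed simp
  then obtain I where "((\<lambda>t. (1 - t) * (1 - t\<^sup>2) powr (-\<alpha>)) has_integral I) {0..1::real}" by blast
  hence "((\<lambda>t. 1 * majorant \<alpha> t) has_integral I) {0..1}"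
    by (intro majorant_by_parts[where M = 1 and k = "\<lambda>t. 1 - t"] assms)
       (auto intro!: continuous_intros derivative_eq_intros)
  thus ?thesis by auto
qed

lemma majorant_times_integrable:
  fixes g :: "real \<Rightarrow> real"
  assumes "1 \<le> \<alpha>" "\<alpha> < 2" "continuous_on {0..1} g"
  shows "(\<lambda>t. g t * majorant \<alpha> t) integrable_on {0..1}"
proof -
  have "(\<lambda>t. g t * majorant \<alpha> t) absolutely_integrable_on {0..1}"
  proof (rule absolutely_integrable_bounded_measurable_product_real)
    show "g \<in> borel_measurable (lebesgue_on {0..1})"
      using assms by (intro continuous_imp_measurable_on_sets_lebesgue) auto
    show "bounded (g ` {0..1})"
      using assms by (intro compact_imp_bounded compact_continuous_image) auto
    show "majorant \<alpha> absolutely_integrable_on {0..1}"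
      by (intro nonnegative_absolutely_integrable_1 majorant_integrable assms majorant_nonneg)
  qed auto
  thus ?thesis by (simp add: set_lebesgue_integral_eq_integral)
qed

text \<open>The form of integration by parts in which all later integrals of the majorant are
  evaluated: the factor \<open>1 - t\<^sup>2\<close> lowers the exponent of the weight to an integrable one.\<close>
lemma majorant_integral_eq_weight_integral:
  assumes "1 \<le> \<alpha>" "\<alpha> < 2" and "continuous_on {0..1} q"
    and "\<And>t. t \<in> {0<..<1} \<Longrightarrow> ((\<lambda>t. (1 - t\<^sup>2) * q t) has_real_derivative - k' t) (at t)"
  shows "((\<lambda>t. k' t * majorant \<alpha> t) has_integral
            integral {0..1} (\<lambda>t. q t * (1 - t\<^sup>2) powr (1 - \<alpha>))) {0..1}"
proof -
  have "bounded (q ` {0..1})"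
    using assms by (intro compact_imp_bounded compact_continuous_image) auto
  then obtain B where B: "\<And>t. t \<in> {0..1} \<Longrightarrow> \<bar>q t\<bar> \<le> B"
    unfolding bounded_iff by (metis imageI real_norm_def)
  have "0 \<le> B" using B[of 0] by simp
  have "(\<lambda>t. q t * (1 - t\<^sup>2) powr ((2 - \<alpha>) - 1)) integrable_on {0..1::real}"
    by (rule weight_times_integrable) (use assms in auto)
  hence "((\<lambda>t. q t * (1 - t\<^sup>2) powr (1 - \<alpha>)) has_integral
            integral {0..1} (\<lambda>t. q t * (1 - t\<^sup>2) powr (1 - \<alpha>))) {0..1}" by auto
  hence "((\<lambda>t. ((1 - t\<^sup>2) * q t) * (1 - t\<^sup>2) powr (-\<alpha>)) has_integral
            integral {0..1} (\<lambda>t. q t * (1 - t\<^sup>2) powr (1 - \<alpha>))) {0..1}"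
  proof (rule has_integral_spike_finite[where S = "{1}", rotated 2])
    fix t :: real assume "t \<in> {0..1} - {1}"
    hence t: "0 < 1 - t\<^sup>2" using weight_pos[of t] by auto
    have "(1 - t\<^sup>2) powr (1 - \<alpha>) = (1 - t\<^sup>2) powr (1 + (-\<alpha>))" by simp
    also have "\<dots> = (1 - t\<^sup>2) powr 1 * (1 - t\<^sup>2) powr (-\<alpha>)" by (rule powr_add)
    finally show "(1 - t\<^sup>2) * q t * (1 - t\<^sup>2) powr (-\<alpha>) = q t * (1 - t\<^sup>2) powr (1 - \<alpha>)"
      using t by simp
  qed simp
  thus ?thesis
  proof (rule majorant_by_parts[where M = "2 * B", rotated 5])
    fix t :: real assume t: "t \<in> {0..1}"
    have "0 \<le> (1 - t)\<^sup>2" by simp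
    hence "1 - t\<^sup>2 \<le> 2 * (1 - t)" by (simp add: power2_eq_square algebra_simps)
    moreover have "0 \<le> 1 - t\<^sup>2" using t by (simp add: power_le_one_iff abs_square_le_1)
    ultimately have *: "1 - t\<^sup>2 \<le> 2 * (1 - t)" "0 \<le> 1 - t\<^sup>2" by auto
    hence "(1 - t\<^sup>2) * \<bar>q t\<bar> \<le> (2 * (1 - t)) * B"
      using t B[OF t] \<open>0 \<le> B\<close> * by (intro mult_mono) auto
    thus "\<bar>(1 - t\<^sup>2) * q t\<bar> \<le> 2 * B * (1 - t)"
      unfolding abs_mult abs_of_nonneg[OF *(2)] by (simp add: mult_ac)
  qed (use assms in \<open>auto intro!: continuous_intros\<close>)
qed

definition weight_mass :: "real \<Rightarrow> real" where
  "weight_mass \<beta> = integral {0..1} (\<lambda>t. (1 - t\<^sup>2) powr (\<beta> - 1))"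

lemma has_integral_weight:
  "0 < \<beta> \<Longrightarrow> ((\<lambda>t. (1 - t\<^sup>2) powr (\<beta> - 1)) has_integral weight_mass \<beta>) {0..1}"
  unfolding weight_mass_def by (intro integrable_integral weight_integrable)

lemma weight_mass_nonneg: "0 < \<beta> \<Longrightarrow> 0 \<le> weight_mass \<beta>"
  unfolding weight_mass_def by (intro integral_nonneg weight_integrable) auto

lemma majorant_moment:
  assumes "1 \<le> \<alpha>" "\<alpha> < 2"
  shows "((\<lambda>t. t * majorant \<alpha> t) has_integral weight_mass (2 - \<alpha>) / 2) {0..1}"
proof -
  have "((\<lambda>t. t * majorant \<alpha> t) has_integral
     integral {0..1} (\<lambda>t. 1/2 * (1 - t\<^sup>2) powr (1 - \<alpha>))) {0..1}"
    by (rule majorant_integral_eq_weight_integral[OF assms])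
       (auto intro!: derivative_eq_intros)
  thus ?thesis using assms by (simp add: weight_mass_def)
qed

lemma majorant_moment_weighted:
  assumes "1 \<le> \<alpha>" "\<alpha> < 2"
  shows "((\<lambda>t. t * (1 - t\<^sup>2) * majorant \<alpha> t) has_integral weight_mass (3 - \<alpha>) / 4) {0..1}"
proof -
  have "((\<lambda>t. t * (1 - t\<^sup>2) * majorant \<alpha> t) has_integral
     integral {0..1} (\<lambda>t. 1/4 * (1 - t\<^sup>2) * (1 - t\<^sup>2) powr (1 - \<alpha>))) {0..1}"
  proof (rule majorant_integral_eq_weight_integral[OF assms])
    fix t :: real
    have "((\<lambda>t. (1 - t\<^sup>2) * (1/4 * (1 - t\<^sup>2))) has_real_derivative
       (- (2 * t)) * (1/4 * (1 - t\<^sup>2)) + (1/4 * (- (2 * t))) * (1 - t\<^sup>2)) (at t)"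
      by (auto intro!: derivative_eq_intros)
    thus "((\<lambda>t. (1 - t\<^sup>2) * (1/4 * (1 - t\<^sup>2))) has_real_derivative - (t * (1 - t\<^sup>2))) (at t)"
      by simp
  qed (auto intro!: continuous_intros)
  also have "integral {0..1} (\<lambda>t. 1/4 * (1 - t\<^sup>2) * (1 - t\<^sup>2) powr (1 - \<alpha>)) =
     integral {0..1} (\<lambda>t. 1/4 * (1 - t\<^sup>2) powr (3 - \<alpha> - 1))"
  proof (rule integral_cong)
    fix t :: real assume "t \<in> {0..1}"
    hence "0 \<le> 1 - t\<^sup>2" by (simp add: power_le_one_iff abs_square_le_1)
    moreover have "(1 - t\<^sup>2) powr (3 - \<alpha> - 1) = (1 - t\<^sup>2) powr (1 + (1 - \<alpha>))" by simp
    ultimately show "1/4 * (1 - t\<^sup>2) * (1 - t\<^sup>2) powr (1 - \<alpha>) = 1/4 * (1 - t\<^sup>2) powr (3 - \<alpha> - 1)"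
      by (simp only: powr_add) simp
  qed
  finally show ?thesis by (simp add: weight_mass_def)
qed

lemma square_kernel_pos:
  fixes t v :: real
  assumes "t \<in> {0..1}" "0 \<le> v" "v < 1"
  shows "0 < 1 - t\<^sup>2 * v"
proof -
  have "t\<^sup>2 * v \<le> 1 * v"
    by (rule mult_right_mono) (use assms in \<open>auto simp: power_le_one_iff abs_square_le_1\<close>)
  thus ?thesis using assms by simp
qed

text \<open>This antiderivative, unlike others of the same function, vanishes at \<open>t = 1\<close> and needs no
  case distinction at \<open>v = 0\<close>.\<close>
lemma square_kernel_antiderivative:
  fixes t v :: real
  assumes "1 - t\<^sup>2 * v \<noteq> 0" "v \<noteq> 1"
  shows "((\<lambda>t. (1 - t\<^sup>2) * (1 / (2 * (1 - v) * (1 - t\<^sup>2 * v)))) has_real_derivative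
           - (t / (1 - t\<^sup>2 * v)\<^sup>2)) (at t within S)"
proof -
  have "((\<lambda>t. (1 - t\<^sup>2) / (2 * (1 - v) * (1 - t\<^sup>2 * v))) has_real_derivative
      (- (2 * t) * (2 * (1 - v) * (1 - t\<^sup>2 * v)) - (1 - t\<^sup>2) * (2 * (1 - v) * (- (2 * t * v)))) /
      ((2 * (1 - v) * (1 - t\<^sup>2 * v)) * (2 * (1 - v) * (1 - t\<^sup>2 * v)))) (at t within S)"
    using assms by (intro DERIV_divide) (auto intro!: derivative_eq_intros)
  also have "- (2 * t) * (2 * (1 - v) * (1 - t\<^sup>2 * v)) - (1 - t\<^sup>2) * (2 * (1 - v) * (- (2 * t * v)))
      = - t * ((2 * (1 - v)) * (2 * (1 - v)))" by (simp add: algebra_simps power2_eq_square)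
  also have "- t * ((2 * (1 - v)) * (2 * (1 - v))) / ((2 * (1 - v) * (1 - t\<^sup>2 * v)) * (2 * (1 - v) * (1 - t\<^sup>2 * v)))
      = (- t / ((1 - t\<^sup>2 * v) * (1 - t\<^sup>2 * v))) * ((2 * (1 - v) * (2 * (1 - v))) / (2 * (1 - v) * (2 * (1 - v))))"
    by (simp only: times_divide_times_eq mult_ac)
  also have "(2 * (1 - v) * (2 * (1 - v))) / (2 * (1 - v) * (2 * (1 - v))) = 1" using assms by simp
  finally show ?thesis by (simp add: power2_eq_square)
qed

lemma majorant_square_kernel:
  assumes "1 \<le> \<alpha>" "\<alpha> < 2" "0 \<le> v" "v < 1"
  shows "((\<lambda>t. t / (1 - t\<^sup>2 * v)\<^sup>2 * majorant \<alpha> t) has_integral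
     integral {0..1} (\<lambda>t. (1 - t\<^sup>2) powr (1 - \<alpha>) / (1 - t\<^sup>2 * v)) / (2 * (1 - v))) {0..1}"
proof -
  note nz = square_kernel_pos[OF _ assms(3,4)]
  have "((\<lambda>t. t / (1 - t\<^sup>2 * v)\<^sup>2 * majorant \<alpha> t) has_integral
     integral {0..1} (\<lambda>t. 1 / (2 * (1 - v) * (1 - t\<^sup>2 * v)) * (1 - t\<^sup>2) powr (1 - \<alpha>))) {0..1}"
  proof (rule majorant_integral_eq_weight_integral[OF assms(1,2)])
    show "continuous_on {0..1} (\<lambda>t. 1 / (2 * (1 - v) * (1 - t\<^sup>2 * v)))"
      using assms nz by (auto intro!: continuous_intros) (force+)?
    fix t :: real assume t: "t \<in> {0<..<1}"
    hence p: "1 - t\<^sup>2 * v \<noteq> 0" using nz[of t] by auto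
    show "((\<lambda>t. (1 - t\<^sup>2) * (1 / (2 * (1 - v) * (1 - t\<^sup>2 * v)))) has_real_derivative - (t / (1 - t\<^sup>2 * v)\<^sup>2)) (at t)"
      by (rule square_kernel_antiderivative[OF p]) (use assms in simp)
  qed
  also have "integral {0..1} (\<lambda>t. 1 / (2 * (1 - v) * (1 - t\<^sup>2 * v)) * (1 - t\<^sup>2) powr (1 - \<alpha>)) =
     integral {0..1} (\<lambda>t. 1 / (2 * (1 - v)) * ((1 - t\<^sup>2) powr (1 - \<alpha>) / (1 - t\<^sup>2 * v)))"
    by simp
  also have "\<dots> = integral {0..1} (\<lambda>t. (1 - t\<^sup>2) powr (1 - \<alpha>) / (1 - t\<^sup>2 * v)) / (2 * (1 - v))"
    by (subst integral_mult_right) simp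
  finally show ?thesis .
qed

text \<open>The substitution \<open>t = s / sqrt Y\<close>, \<open>Y = 1 - v (1 - s\<^sup>2)\<close>, gives \<open>1 - t\<^sup>2 = (1 - v) (1 - s\<^sup>2) / Y\<close> and
  \<open>1 - t\<^sup>2 v = (1 - v) / Y\<close>. It removes the singular kernel: what remains is the original weight
  times a power of \<open>Y\<close> whose exponent changes sign at \<open>\<beta> = 1/2\<close>.\<close>
lemma weight_kernel_transform:
  fixes \<beta> v :: real
  assumes "0 < \<beta>" "0 \<le> v" "v < 1"
  shows "((\<lambda>s. (1 - s\<^sup>2) powr (\<beta> - 1) * (1 - v * (1 - s\<^sup>2)) powr (1/2 - \<beta>)) has_integral
     (1 - v) powr (1 - \<beta>) * integral {0..1} (\<lambda>t. (1 - t\<^sup>2) powr (\<beta> - 1) / (1 - t\<^sup>2 * v))) {0..1}"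
proof -
  note nz = square_kernel_pos[OF _ assms(2,3)]
  define Y where "Y = (\<lambda>s::real. 1 - v * (1 - s\<^sup>2))"
  define I where "I = integral {0..1} (\<lambda>t. (1 - t\<^sup>2) powr (\<beta> - 1) / (1 - t\<^sup>2 * v))"
  have Y: "Y s > 0" for s
  proof -
    have "v * (1 - s\<^sup>2) \<le> v * 1" using assms by (intro mult_left_mono) auto
    thus ?thesis using assms by (simp add: Y_def)
  qed
  have "(\<lambda>t. 1 / (1 - t\<^sup>2 * v) * (1 - t\<^sup>2) powr (\<beta> - 1)) integrable_on {0..1}"
    by (rule weight_times_integrable) (use assms(1) in \<open>auto intro!: continuous_intros dest: nz\<close>)
  hence I: "((\<lambda>t. (1 - t\<^sup>2) powr (\<beta> - 1) / (1 - t\<^sup>2 * v)) has_integral I) {0..1}"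
    by (auto simp: I_def)
  have subst: "((\<lambda>s. (\<lambda>t. (1 - t\<^sup>2) powr (\<beta> - 1) / (1 - t\<^sup>2 * v)) (s / sqrt (Y s)) * ((1 - v) / (sqrt (Y s))^3))
          has_integral I) {0..1}"
  proof (rule has_integral_substitution_unit[OF I])
    show "continuous_on {0<..<1} (\<lambda>t. (1 - t\<^sup>2) powr (\<beta> - 1) / (1 - t\<^sup>2 * v))"
    proof -
      have "1 - t\<^sup>2 * v \<noteq> 0" "1 - t\<^sup>2 \<noteq> 0" if "t \<in> {0<..<1}" for t
        using that nz[of t] weight_pos[of t] by auto
      thus ?thesis by (auto intro!: continuous_intros simp del: right_minus_eq)
    qed
    show "continuous_on {0..1} (\<lambda>s. s / sqrt (Y s))"
      using Y by (auto intro!: continuous_intros simp: Y_def less_imp_neq[symmetric])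
    show "1 / sqrt (Y 1) = 1" "0 / sqrt (Y 0) = 0" by (auto simp: Y_def)
  next
    fix s :: real assume s: "s \<in> {0<..<1}"
    have Y': "(Y has_real_derivative 2 * v * s) (at s)"
      unfolding Y_def by (auto intro!: derivative_eq_intros)
    have sq: "sqrt (Y s) * sqrt (Y s) = Y s" using Y[of s] by simp
    have "((\<lambda>s. sqrt (Y s)) has_real_derivative inverse (sqrt (Y s)) / 2 * (2 * v * s)) (at s)"
      by (rule DERIV_chain2[OF DERIV_real_sqrt[OF Y] Y'])
    from DERIV_divide[OF DERIV_ident this]
    have "((\<lambda>s. s / sqrt (Y s)) has_real_derivative
       (1 * sqrt (Y s) - s * (inverse (sqrt (Y s)) / 2 * (2 * v * s))) / (sqrt (Y s) * sqrt (Y s))) (at s)"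
      using Y[of s] by simp
    also have "(1 * sqrt (Y s) - s * (inverse (sqrt (Y s)) / 2 * (2 * v * s))) / (sqrt (Y s) * sqrt (Y s))
        = (sqrt (Y s) * sqrt (Y s) - v * s\<^sup>2) / (sqrt (Y s))^3"
      using Y[of s] by (simp add: field_simps power2_eq_square power3_eq_cube)
    also have "sqrt (Y s) * sqrt (Y s) - v * s\<^sup>2 = 1 - v"
      unfolding sq by (simp add: Y_def algebra_simps)
    finally show "((\<lambda>s. s / sqrt (Y s)) has_real_derivative (1 - v) / (sqrt (Y s))^3) (at s)" .
    have "s\<^sup>2 < Y s"
    proof -
      have "0 < (1 - v) * (1 - s\<^sup>2)" using s assms weight_pos[of s] by simp
      thus ?thesis by (simp add: Y_def algebra_simps)
    qed
    hence "s < sqrt (Y s)" using s by (simp add: real_less_rsqrt)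
    thus "s / sqrt (Y s) \<in> {0<..<1}" using s Y[of s] by simp
  qed
  have Y_eq: "1 - v * (1 - s\<^sup>2) = Y s" for s by (simp add: Y_def)
  from has_integral_mult_right[OF subst, of "(1 - v) powr (1 - \<beta>)"]
  have "((\<lambda>s. (1 - v) powr (1 - \<beta>) * ((1 - (s / sqrt (Y s))\<^sup>2) powr (\<beta> - 1) / (1 - (s / sqrt (Y s))\<^sup>2 * v) *
      ((1 - v) / (sqrt (Y s))^3))) has_integral (1 - v) powr (1 - \<beta>) * I) {0..1}"
    by simp
  thus ?thesis
    unfolding I_def[symmetric] Y_eq
  proof (rule has_integral_spike_finite[where S = "{1}", rotated 2])
    fix s :: real assume "s \<in> {0..1} - {1}"
    hence s: "0 < 1 - s\<^sup>2" using weight_pos[of s] by auto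
    have g2: "(s / sqrt (Y s))\<^sup>2 = s\<^sup>2 / Y s" using Y[of s] by (simp add: power_divide)
    have e1: "1 - s\<^sup>2 / Y s = (1 - v) * (1 - s\<^sup>2) / Y s" 
      using Y[of s] by (simp add: field_simps) (simp add: Y_def algebra_simps)
    have e2: "1 - s\<^sup>2 / Y s * v = (1 - v) / Y s"
      using Y[of s] by (simp add: field_simps) (simp add: Y_def algebra_simps)
    have e3: "(sqrt (Y s))^3 = Y s powr (3/2)"
      using Y[of s] by (simp add: powr_half_sqrt[symmetric] powr_power)
    have e4: "((1 - v) * (1 - s\<^sup>2) / Y s) powr (\<beta> - 1)
       = (1 - v) powr (\<beta> - 1) * (1 - s\<^sup>2) powr (\<beta> - 1) * Y s powr (1 - \<beta>)"
    proof -
      have a: "Y s powr (1 - \<beta>) = 1 / Y s powr (\<beta> - 1)"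
        using powr_minus_divide[of "Y s" "\<beta> - 1"] by simp
      show ?thesis unfolding a powr_divide powr_mult by simp
    qed
    have e5: "Y s powr (1 - \<beta>) * Y s / Y s powr (3/2) = Y s powr (1/2 - \<beta>)"
    proof -
      have "Y s powr (1 - \<beta>) * Y s / Y s powr (3/2) = Y s powr (1 - \<beta> + 1 - 3/2)"
        using Y[of s] by (simp only: powr_diff powr_add) simp
      thus ?thesis by simp
    qed
    have e6: "(1 - v) powr (1 - \<beta>) * (1 - v) powr (\<beta> - 1) = 1"
      using assms by (simp flip: powr_add)
    have "(1 - v) powr (1 - \<beta>) * ((1 - (s / sqrt (Y s))\<^sup>2) powr (\<beta> - 1) / (1 - (s / sqrt (Y s))\<^sup>2 * v) *
      ((1 - v) / (sqrt (Y s))^3)) = ((1 - v) powr (1 - \<beta>) * (1 - v) powr (\<beta> - 1)) * (1 - s\<^sup>2) powr (\<beta> - 1) *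
        (Y s powr (1 - \<beta>) * Y s / Y s powr (3/2))"
      unfolding g2 e1 e2 e3 e4 using assms Y[of s] by simp
    thus "(1 - s\<^sup>2) powr (\<beta> - 1) * Y s powr (1/2 - \<beta>) = (1 - v) powr (1 - \<beta>) *
       ((1 - (s / sqrt (Y s))\<^sup>2) powr (\<beta> - 1) / (1 - (s / sqrt (Y s))\<^sup>2 * v) * ((1 - v) / (sqrt (Y s))^3))"
      unfolding e5 e6 by simp
  qed simp
qed

section \<open>The logarithmic weight and the kernel\<close>


lemma L_eq: "r < 1 \<Longrightarrow> L r = 1 - 2 * ln (1 - r)"
  by (simp add: L_def ln_div ln_realpow)

text \<open>The derivative of the difference is the tail of a geometric series.\<close>
lemma neg_ln_ge_sum:
  assumes "0 \<le> r" "r < 1"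
  shows "(\<Sum>k<n. r ^ Suc k / Suc k) \<le> - ln (1 - r)"
proof -
  let ?D = "\<lambda>x. - ln (1 - x) - (\<Sum>k<n. x ^ Suc k / Suc k)"
  have "?D 0 \<le> ?D r"
  proof (rule DERIV_nonneg_imp_nondecreasing[OF assms(1)])
    fix x :: real assume x: "0 \<le> x" "x \<le> r"
    have "(?D has_real_derivative 1 / (1 - x) - (\<Sum>k<n. x ^ k)) (at x)"
      using x assms by (auto intro!: derivative_eq_intros simp del: power_Suc)
    moreover have "(\<Sum>k<n. x ^ k) \<le> 1 / (1 - x)"
      using x assms by (simp add: sum_gp_strict divide_right_mono)
    ultimately show "\<exists>y. (?D has_real_derivative y) (at x) \<and> 0 \<le> y" by force
  qed
  thus ?thesis by simp
qed

lemma L_ge_poly: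
  assumes "0 \<le> r" "r < 1"
  shows "1 + 2 * (r + r^2/2 + r^3/3 + r^4/4 + r^5/5 + r^6/6 + r^7/7) \<le> L r"
  using neg_ln_ge_sum[OF assms, of 7] assms
  by (simp add: L_eq eval_nat_numeral)

lemma L_ge_square:
  assumes "0 \<le> r" "r < 1"
  shows "(1 + r)\<^sup>2 \<le> L r"
proof -
  have "0 \<le> r^3/3 + r^4/4 + r^5/5 + r^6/6 + r^7/7" using assms by simp
  thus ?thesis using L_ge_poly[OF assms] by (simp add: power2_eq_square algebra_simps)
qed

lemma L_pos: "0 \<le> r \<Longrightarrow> r < 1 \<Longrightarrow> 0 < L r"
  using L_ge_square[of r] zero_less_power[of "1 + r" 2] by linarith

lemma kernel_pos:
  fixes r t :: real
  assumes "t \<in> {0..1}" "0 \<le> r" "r < 1"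
  shows "0 < 1 - t * r"
proof -
  have "t * r \<le> 1 * r" using assms by (intro mult_right_mono) auto
  thus ?thesis using assms by simp
qed

lemma kernel_eq_square_kernel:
  fixes r t :: real
  assumes "t \<in> {0..1}" "0 \<le> r" "r < 1"
  shows "1 / (1 - t * r)\<^sup>2 = (1 + t * r)\<^sup>2 / (1 - t\<^sup>2 * r\<^sup>2)\<^sup>2"
proof -
  have "1 - t\<^sup>2 * r\<^sup>2 = (1 - t * r) * (1 + t * r)" by (simp add: power2_eq_square algebra_simps)
  moreover have "0 < 1 - t * r" "0 < 1 + t * r" using kernel_pos[OF assms] assms by (auto intro: add_pos_nonneg)
  ultimately show ?thesis by (simp add: power_mult_distrib)
qed

text \<open>Passing to the even kernel costs only \<open>(1 + r)\<^sup>2\<close>, which is the beginning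
  \<open>1 + 2 r + r\<^sup>2\<close> of the power series of \<open>L r\<close>.\<close>
lemma kernel_le_square_kernel:
  fixes r t :: real
  assumes "t \<in> {0..1}" "0 \<le> r" "r < 1"
  shows "1 / (1 - t * r)\<^sup>2 \<le> (1 + r)\<^sup>2 / (1 - t\<^sup>2 * r\<^sup>2)\<^sup>2"
proof -
  have "t * r \<le> 1 * r" using assms by (intro mult_right_mono) auto
  hence "(1 + t * r)\<^sup>2 \<le> (1 + r)\<^sup>2" using assms by (intro power_mono) auto
  thus ?thesis unfolding kernel_eq_square_kernel[OF assms] by (rule divide_right_mono) simp
qed

lemma r_square: "0 \<le> r \<Longrightarrow> r < 1 \<Longrightarrow> r\<^sup>2 < (1::real)"
  by (simp add: power_less_one_iff abs_square_less_1)

lemma continuous_kernel: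
  "0 \<le> r \<Longrightarrow> r < 1 \<Longrightarrow> continuous_on {0..1::real} (\<lambda>t. t / (1 - t * r)\<^sup>2)"
  by (auto intro!: continuous_intros dest: kernel_pos)

lemma kernel_integral_le:
  fixes r :: real
  assumes "0 \<le> r" "r < 1"
  shows "integral {0..1} (\<lambda>t. t / (1 - t * r)\<^sup>2) \<le> (1 + r)\<^sup>2 / (2 * (1 - r\<^sup>2))"
proof -
  note v = r_square[OF assms]
  let ?G = "\<lambda>t. (1 + r)\<^sup>2 * (- ((1 - t\<^sup>2) * (1 / (2 * (1 - r\<^sup>2) * (1 - t\<^sup>2 * r\<^sup>2)))))"
  have nz: "1 - t\<^sup>2 * r\<^sup>2 \<noteq> 0" if "t \<in> {0..1}" for t
    using square_kernel_pos[OF that zero_le_power2 v] by simp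
  have "((\<lambda>t. (1 + r)\<^sup>2 * (t / (1 - t\<^sup>2 * r\<^sup>2)\<^sup>2)) has_integral ?G 1 - ?G 0) {0..1}"
  proof (rule fundamental_theorem_of_calculus)
    fix t :: real assume t: "t \<in> {0..1}"
    show "(?G has_vector_derivative (1 + r)\<^sup>2 * (t / (1 - t\<^sup>2 * r\<^sup>2)\<^sup>2)) (at t within {0..1})"
      unfolding has_real_derivative_iff_has_vector_derivative[symmetric]
    proof (rule DERIV_cmult)
      from DERIV_minus[OF square_kernel_antiderivative[OF nz[OF t], of "{0..1}"]] v
      show "((\<lambda>t. - ((1 - t\<^sup>2) * (1 / (2 * (1 - r\<^sup>2) * (1 - t\<^sup>2 * r\<^sup>2))))) has_real_derivative
        t / (1 - t\<^sup>2 * r\<^sup>2)\<^sup>2) (at t within {0..1})" by simp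
    qed
  qed simp
  moreover have "((\<lambda>t. t / (1 - t * r)\<^sup>2) has_integral integral {0..1} (\<lambda>t. t / (1 - t * r)\<^sup>2)) {0..1}"
    by (intro integrable_integral integrable_continuous_real continuous_kernel assms)
  moreover have "t / (1 - t * r)\<^sup>2 \<le> (1 + r)\<^sup>2 * (t / (1 - t\<^sup>2 * r\<^sup>2)\<^sup>2)" if "t \<in> {0..1}" for t
    using mult_left_mono[OF kernel_le_square_kernel[OF that assms], of t] that by (simp add: mult_ac)
  ultimately have "integral {0..1} (\<lambda>t. t / (1 - t * r)\<^sup>2) \<le> ?G 1 - ?G 0"
    by (blast intro: has_integral_le)
  thus ?thesis by simp
qed

text \<open>Since \<open>1 - r\<^sup>2 \<le> 1\<close>, the exponent \<open>\<alpha>\<close> may be replaced by \<open>1\<close>; then the factor \<open>1 - r\<^sup>2\<close> cancels against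
  the integral of the even kernel.\<close>
lemma constant_term_bound:
  assumes "1 \<le> \<alpha>" "0 \<le> r" "r < 1"
  shows "(1 - r\<^sup>2) powr \<alpha> / L r * integral {0..1} (\<lambda>t. t / (1 - t * r)\<^sup>2) \<le> 1/2"
proof -
  note v = r_square[OF assms(2,3)]
  have "(1 - r\<^sup>2) powr \<alpha> * integral {0..1} (\<lambda>t. t / (1 - t * r)\<^sup>2)
     \<le> (1 - r\<^sup>2) powr 1 * ((1 + r)\<^sup>2 / (2 * (1 - r\<^sup>2)))"
    using assms v
    by (intro mult_mono kernel_integral_le powr_mono' integral_nonneg integrable_continuous_real continuous_kernel) auto
  also have "\<dots> = (1 + r)\<^sup>2 / 2"
    using v by (simp del: right_diff_distrib_numeral)
  also have "\<dots> \<le> L r / 2" using L_ge_square[OF assms(2,3)] by simp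
  finally show ?thesis using L_pos[OF assms(2,3)] by (simp add: field_simps)
qed

section \<open>The majorant under the kernel\<close>


definition majorant_transform :: "real \<Rightarrow> real \<Rightarrow> real" where
  "majorant_transform \<alpha> r = integral {0..1} (\<lambda>t. t / (1 - t * r)\<^sup>2 * majorant \<alpha> t)"

text \<open>The integral obtained by \<open>weight_kernel_transform\<close>; at \<open>v = 0\<close> it is \<open>weight_mass \<beta>\<close>.\<close>
definition transformed_mass :: "real \<Rightarrow> real \<Rightarrow> real" where
  "transformed_mass \<beta> v = integral {0..1} (\<lambda>s. (1 - s\<^sup>2) powr (\<beta> - 1) * (1 - v * (1 - s\<^sup>2)) powr (1/2 - \<beta>))"

lemma has_integral_majorant_transform:
  assumes "1 \<le> \<alpha>" "\<alpha> < 2" "0 \<le> r" "r < 1"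
  shows "((\<lambda>t. t / (1 - t * r)\<^sup>2 * majorant \<alpha> t) has_integral majorant_transform \<alpha> r) {0..1}"
  unfolding majorant_transform_def
  by (intro integrable_integral majorant_times_integrable assms continuous_kernel)

lemma square_kernel_majorant:
  assumes "1 \<le> \<alpha>" "\<alpha> < 2" "0 \<le> r" "r < 1"
  obtains J where "((\<lambda>t. t / (1 - t\<^sup>2 * r\<^sup>2)\<^sup>2 * majorant \<alpha> t) has_integral J) {0..1}"
    "(1 - r\<^sup>2) powr \<alpha> * J = transformed_mass (2 - \<alpha>) (r\<^sup>2) / 2"
proof
  note v = r_square[OF assms(3,4)]
  let ?I = "integral {0..1} (\<lambda>t. (1 - t\<^sup>2) powr (1 - \<alpha>) / (1 - t\<^sup>2 * r\<^sup>2))"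
  show "((\<lambda>t. t / (1 - t\<^sup>2 * r\<^sup>2)\<^sup>2 * majorant \<alpha> t) has_integral ?I / (2 * (1 - r\<^sup>2))) {0..1}"
    by (rule majorant_square_kernel) (use assms v in auto)
  have "transformed_mass (2 - \<alpha>) (r\<^sup>2) = (1 - r\<^sup>2) powr (\<alpha> - 1) * ?I"
    unfolding transformed_mass_def
    using weight_kernel_transform[of "2 - \<alpha>" "r\<^sup>2"] assms v by (simp add: integral_unique)
  thus "(1 - r\<^sup>2) powr \<alpha> * (?I / (2 * (1 - r\<^sup>2))) = transformed_mass (2 - \<alpha>) (r\<^sup>2) / 2"
    using v by (simp add: powr_diff)
qed

lemma majorant_transform_le:
  assumes "1 \<le> \<alpha>" "\<alpha> < 2" "0 \<le> r" "r < 1"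
  shows "(1 - r\<^sup>2) powr \<alpha> * majorant_transform \<alpha> r \<le> (1 + r)\<^sup>2 * transformed_mass (2 - \<alpha>) (r\<^sup>2) / 2"
proof -
  obtain J where J: "((\<lambda>t. t / (1 - t\<^sup>2 * r\<^sup>2)\<^sup>2 * majorant \<alpha> t) has_integral J) {0..1}"
    "(1 - r\<^sup>2) powr \<alpha> * J = transformed_mass (2 - \<alpha>) (r\<^sup>2) / 2"
    by (rule square_kernel_majorant[OF assms])
  have "majorant_transform \<alpha> r \<le> (1 + r)\<^sup>2 * J"
  proof (rule has_integral_le[OF has_integral_majorant_transform[OF assms] has_integral_mult_right[OF J(1)]])
    fix t :: real assume t: "t \<in> {0..1}"
    have "1 / (1 - t * r)\<^sup>2 * (t * majorant \<alpha> t) \<le> (1 + r)\<^sup>2 / (1 - t\<^sup>2 * r\<^sup>2)\<^sup>2 * (t * majorant \<alpha> t)"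
      by (rule mult_right_mono[OF kernel_le_square_kernel]) (use t assms in \<open>auto simp: majorant_nonneg\<close>)
    thus "t / (1 - t * r)\<^sup>2 * majorant \<alpha> t \<le> (1 + r)\<^sup>2 * (t / (1 - t\<^sup>2 * r\<^sup>2)\<^sup>2 * majorant \<alpha> t)"
      by (simp add: mult_ac)
  qed
  hence "(1 - r\<^sup>2) powr \<alpha> * majorant_transform \<alpha> r \<le> (1 - r\<^sup>2) powr \<alpha> * ((1 + r)\<^sup>2 * J)"
    by (intro mult_left_mono) auto
  also have "\<dots> = (1 + r)\<^sup>2 * ((1 - r\<^sup>2) powr \<alpha> * J)" by simp
  finally show ?thesis unfolding J(2) by simp
qed

text \<open>Compared with the previous bound, \<open>(1 + t r)\<^sup>2 \<le> (1 + r)\<^sup>2\<close> is sharpened to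
  \<open>(1 + t r)\<^sup>2 \<le> (1 + r)\<^sup>2 - r (1 + r) (1 - t\<^sup>2)\<close>; the two sides differ by \<open>r (1 - t)\<^sup>2\<close>.\<close>
lemma majorant_transform_le_refined:
  assumes "1 \<le> \<alpha>" "\<alpha> < 2" "0 \<le> r" "r < 1"
  shows "(1 - r\<^sup>2) powr \<alpha> * majorant_transform \<alpha> r
     \<le> (1 + r)\<^sup>2 * transformed_mass (2 - \<alpha>) (r\<^sup>2) / 2
        - r * (1 + r) * ((1 - r\<^sup>2) powr \<alpha> * weight_mass (3 - \<alpha>) / 4)"
proof -
  obtain J where J: "((\<lambda>t. t / (1 - t\<^sup>2 * r\<^sup>2)\<^sup>2 * majorant \<alpha> t) has_integral J) {0..1}"
    "(1 - r\<^sup>2) powr \<alpha> * J = transformed_mass (2 - \<alpha>) (r\<^sup>2) / 2"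
    by (rule square_kernel_majorant[OF assms])
  have "majorant_transform \<alpha> r \<le> (1 + r)\<^sup>2 * J - r * (1 + r) * (weight_mass (3 - \<alpha>) / 4)"
  proof (rule has_integral_le[OF has_integral_majorant_transform[OF assms] has_integral_diff[OF has_integral_mult_right[OF J(1)]
      has_integral_mult_right[OF majorant_moment_weighted[OF assms(1,2)]]]])
    fix t :: real assume t: "t \<in> {0..1}"
    let ?q = "(1 - t\<^sup>2 * r\<^sup>2)\<^sup>2"
    have q: "0 < 1 - t\<^sup>2 * r\<^sup>2"
      by (rule square_kernel_pos[OF t]) (use r_square[OF assms(3,4)] in auto)
    hence q': "0 < ?q" "?q \<le> 1" by (auto simp: power_le_one_iff)
    have t2: "0 \<le> 1 - t\<^sup>2" using t by (simp add: power_le_one_iff abs_square_le_1)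
    have "0 \<le> r * (1 - t)\<^sup>2" using assms by simp
    hence "(1 + t * r)\<^sup>2 \<le> (1 + r)\<^sup>2 - r * (1 + r) * (1 - t\<^sup>2)"
      by (simp add: power2_eq_square algebra_simps)
    hence "1 / (1 - t * r)\<^sup>2 \<le> ((1 + r)\<^sup>2 - r * (1 + r) * (1 - t\<^sup>2)) / ?q"
      unfolding kernel_eq_square_kernel[OF t assms(3,4)] by (rule divide_right_mono) simp
    also have "\<dots> = (1 + r)\<^sup>2 / ?q - r * (1 + r) * (1 - t\<^sup>2) / ?q" by (rule diff_divide_distrib)
    also have "\<dots> \<le> (1 + r)\<^sup>2 / ?q - r * (1 + r) * (1 - t\<^sup>2)"
    proof -
      have "r * (1 + r) * (1 - t\<^sup>2) * ?q \<le> r * (1 + r) * (1 - t\<^sup>2) * 1"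
        by (rule mult_left_mono[OF q'(2)]) (use assms t2 in auto)
      hence "r * (1 + r) * (1 - t\<^sup>2) \<le> r * (1 + r) * (1 - t\<^sup>2) / ?q"
        using q' by (simp add: pos_le_divide_eq)
      thus ?thesis by simp
    qed
    finally have "1 / (1 - t * r)\<^sup>2 * (t * majorant \<alpha> t) \<le>
      ((1 + r)\<^sup>2 / ?q - r * (1 + r) * (1 - t\<^sup>2)) * (t * majorant \<alpha> t)"
      by (rule mult_right_mono) (use t in \<open>auto simp: majorant_nonneg\<close>)
    thus "t / (1 - t * r)\<^sup>2 * majorant \<alpha> t \<le> (1 + r)\<^sup>2 * (t / ?q * majorant \<alpha> t) -
        r * (1 + r) * (t * (1 - t\<^sup>2) * majorant \<alpha> t)"
      by (simp add: algebra_simps)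
  qed
  hence "(1 - r\<^sup>2) powr \<alpha> * majorant_transform \<alpha> r \<le>
     (1 - r\<^sup>2) powr \<alpha> * ((1 + r)\<^sup>2 * J - r * (1 + r) * (weight_mass (3 - \<alpha>) / 4))"
    by (intro mult_left_mono) auto
  also have "\<dots> = (1 + r)\<^sup>2 * ((1 - r\<^sup>2) powr \<alpha> * J) - r * (1 + r) * ((1 - r\<^sup>2) powr \<alpha> * weight_mass (3 - \<alpha>) / 4)"
    by (simp add: algebra_simps)
  finally show ?thesis unfolding J(2) by simp
qed

lemma has_integral_transformed_mass:
  assumes "0 < \<beta>" "0 \<le> v" "v < 1"
  shows "((\<lambda>s. (1 - s\<^sup>2) powr (\<beta> - 1) * (1 - v * (1 - s\<^sup>2)) powr (1/2 - \<beta>)) has_integral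
     transformed_mass \<beta> v) {0..1}"
  using weight_kernel_transform[OF assms] by (simp add: transformed_mass_def integral_unique)

text \<open>For \<open>\<beta> \<le> 1/2\<close> the power of \<open>Y \<le> 1\<close> has a nonnegative exponent.\<close>
lemma transformed_mass_le:
  assumes "0 < \<beta>" "\<beta> \<le> 1/2" "0 \<le> v" "v < 1"
  shows "transformed_mass \<beta> v \<le> weight_mass \<beta>"
proof (rule has_integral_le[OF has_integral_transformed_mass has_integral_weight])
  fix s :: real assume s: "s \<in> {0..1}"
  have "0 \<le> v * (1 - s\<^sup>2)" "v * (1 - s\<^sup>2) \<le> 1 * 1"
    using assms s by (intro mult_nonneg_nonneg mult_mono; auto simp: power_le_one_iff abs_square_le_1)+
  hence "(1 - v * (1 - s\<^sup>2)) powr (1/2 - \<beta>) \<le> 1"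
    using assms by (intro powr_le1) auto
  thus "(1 - s\<^sup>2) powr (\<beta> - 1) * (1 - v * (1 - s\<^sup>2)) powr (1/2 - \<beta>) \<le> (1 - s\<^sup>2) powr (\<beta> - 1)"
    by (simp add: mult_left_le)
qed (use assms in auto)

lemma majorant_bound_large_exponent:
  assumes "3/2 \<le> \<alpha>" "\<alpha> < 2" "0 \<le> r" "r < 1"
  shows "(1 - r\<^sup>2) powr \<alpha> / L r * majorant_transform \<alpha> r \<le> weight_mass (2 - \<alpha>) / 2"
proof -
  have "(1 - r\<^sup>2) powr \<alpha> * majorant_transform \<alpha> r \<le> (1 + r)\<^sup>2 * transformed_mass (2 - \<alpha>) (r\<^sup>2) / 2"
    by (rule majorant_transform_le) (use assms in auto)
  also have "\<dots> \<le> L r * weight_mass (2 - \<alpha>) / 2"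
  proof (intro divide_right_mono mult_mono L_ge_square transformed_mass_le assms)
    have "((\<lambda>_. 0) has_integral 0) {0..1::real}" by simp
    from has_integral_le[OF this has_integral_transformed_mass[of "2 - \<alpha>" "r\<^sup>2"]]
    show "0 \<le> transformed_mass (2 - \<alpha>) (r\<^sup>2)" using assms r_square[OF assms(3,4)] by simp
  qed (use assms r_square[OF assms(3,4)] L_pos[OF assms(3,4)] in auto)
  finally show ?thesis using L_pos[OF assms(3,4)] by (simp add: field_simps)
qed

section \<open>The range between 4/3 and 3/2\<close>


lemma has_integral_le_interior:
  fixes f g :: "real \<Rightarrow> real"
  assumes "(f has_integral i) {0..1}" "(g has_integral j) {0..1}"
    and "\<And>x. x \<in> {0<..<1} \<Longrightarrow> f x \<le> g x"
  shows "i \<le> j"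
proof (rule has_integral_le)
  let ?r = "\<lambda>h x. if x \<in> {0<..<1::real} then h x else (0::real)"
  show "(?r f has_integral i) {0..1}"
    by (rule has_integral_spike_finite[where S = "{0,1}", OF _ _ assms(1)]) auto
  show "(?r g has_integral j) {0..1}"
    by (rule has_integral_spike_finite[where S = "{0,1}", OF _ _ assms(2)]) auto
qed (use assms(3) in auto)

text \<open>The derivative of \<open>t (1 - t\<^sup>2)\<^sup>\<beta>\<close> is a combination of the two weights, and its integral vanishes.\<close>
lemma weight_mass_rec:
  assumes "0 < \<beta>"
  shows "weight_mass (\<beta> + 1) = 2 * \<beta> / (1 + 2 * \<beta>) * weight_mass \<beta>"
proof -
  let ?G = "\<lambda>t::real. t * (1 - t\<^sup>2) powr \<beta>"
  have ftc: "((\<lambda>t. (1 + 2 * \<beta>) * (1 - t\<^sup>2) powr (\<beta> + 1 - 1) - 2 * \<beta> * (1 - t\<^sup>2) powr (\<beta> - 1)) has_integral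
      ?G 1 - ?G 0) {0..1}"
  proof (rule fundamental_theorem_of_calculus_interior)
    show "continuous_on {0..1} ?G"
      using assms by (intro continuous_intros continuous_on_powr') (auto simp: power_le_one_iff abs_square_le_1)
    fix t :: real assume "t \<in> {0<..<1}"
    hence t: "0 < 1 - t\<^sup>2" using weight_pos[of t] by auto
    have e: "(1 - t\<^sup>2) powr \<beta> = (1 - t\<^sup>2) * (1 - t\<^sup>2) powr (\<beta> - 1)"
      using t powr_mult_base[of "1 - t\<^sup>2" "\<beta> - 1"] by simp
    have d: "((\<lambda>t. (1 - t\<^sup>2) powr \<beta>) has_real_derivative (\<beta> * (1 - t\<^sup>2) powr (\<beta> - 1)) * (- (2 * t))) (at t)"
      by (rule DERIV_chain2[where f = "\<lambda>x. x powr \<beta>" and g = "\<lambda>t. 1 - t\<^sup>2", OF has_real_derivative_powr[OF t]])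
         (auto intro!: derivative_eq_intros)
    have "(?G has_real_derivative 1 * (1 - t\<^sup>2) powr \<beta> + (\<beta> * (1 - t\<^sup>2) powr (\<beta> - 1)) * (- (2 * t)) * t) (at t)"
      by (rule DERIV_mult[OF DERIV_ident d])
    also have "1 * (1 - t\<^sup>2) powr \<beta> + (\<beta> * (1 - t\<^sup>2) powr (\<beta> - 1)) * (- (2 * t)) * t
       = (1 + 2 * \<beta>) * (1 - t\<^sup>2) powr \<beta> - 2 * \<beta> * (1 - t\<^sup>2) powr (\<beta> - 1)"
      unfolding e by (simp add: algebra_simps power2_eq_square)
    finally show "(?G has_vector_derivative (1 + 2 * \<beta>) * (1 - t\<^sup>2) powr (\<beta> + 1 - 1) - 2 * \<beta> * (1 - t\<^sup>2) powr (\<beta> - 1)) (at t)"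
      by (simp add: has_real_derivative_iff_has_vector_derivative)
  qed simp
  have "((\<lambda>t. (1 + 2 * \<beta>) * (1 - t\<^sup>2) powr (\<beta> + 1 - 1) - 2 * \<beta> * (1 - t\<^sup>2) powr (\<beta> - 1)) has_integral
      (1 + 2 * \<beta>) * weight_mass (\<beta> + 1) - 2 * \<beta> * weight_mass \<beta>) {0..1}"
    by (intro has_integral_diff has_integral_mult_right has_integral_weight) (use assms in auto)
  from has_integral_unique[OF this ftc]
  have "(1 + 2 * \<beta>) * weight_mass (\<beta> + 1) - 2 * \<beta> * weight_mass \<beta> = 0" by simp
  thus ?thesis using assms by (simp add: field_simps)
qed

text \<open>Chebyshev's inequality: an increasing weight gives the decreasing function \<open>s\<^sup>-\<^sup>1\<^sup>/\<^sup>3\<close> at most its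
  mean over \<open>[0,1]\<close>, which is \<open>3/2\<close>.\<close>
lemma chebyshev_weight:
  assumes "1/2 \<le> \<beta>" "\<beta> \<le> 1"
  obtains I where "((\<lambda>s. (1 - s\<^sup>2) powr (\<beta> - 1) * s powr (-1/3)) has_integral I) {0..1}"
    "I \<le> 3/2 * weight_mass \<beta>"
proof -
  have "(\<lambda>s. (1 - s\<^sup>2) powr (\<beta> - 1) * s powr (-1/3)) integrable_on {0..1::real}"
  proof (rule measurable_bounded_by_integrable_imp_integrable_real)
    show "(\<lambda>s::real. (1 - s\<^sup>2) powr (\<beta> - 1) * s powr (-1/3)) \<in> borel_measurable (lebesgue_on {0..1})"
      by (auto intro!: measurable_restrict_space1 measurable_completion)
    show "(\<lambda>s::real. s powr (2/3 - 1) * (1 - s) powr (\<beta> - 1)) integrable_on {0..1}"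
      by (rule integrable_Beta') (use assms in auto)
    show "\<bar>(1 - s\<^sup>2) powr (\<beta> - 1) * s powr (-1/3)\<bar> \<le> s powr (2/3 - 1) * (1 - s) powr (\<beta> - 1)"
      if s: "s \<in> {0..1}" for s :: real
    proof (cases "s = 1")
      case False
      have "(1 - s\<^sup>2) powr (\<beta> - 1) \<le> (1 - s) powr (\<beta> - 1)"
        using s False assms by (intro powr_mono2') (auto simp: power2_eq_square mult_left_le_one_le)
      from mult_right_mono[OF this, of "s powr (-1/3)"] show ?thesis
        by (simp add: mult.commute)
    qed auto
  qed auto
  then obtain I where I: "((\<lambda>s. (1 - s\<^sup>2) powr (\<beta> - 1) * s powr (-1/3)) has_integral I) {0..1::real}" by blast
  \<comment> \<open>the point where \<open>s\<^sup>-\<^sup>1\<^sup>/\<^sup>3\<close> takes its mean value \<open>3/2\<close>\<close>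
  define c where "c = (8/27 :: real)"
  have c13: "c powr (-1/3) = 3/2"
  proof -
    have "c = (2/3) powr 3" by (simp add: c_def powr_numeral power3_eq_cube)
    hence "c powr (-1/3) = (2/3) powr (3 * (-1/3))" by (simp only: powr_powr)
    thus ?thesis by (simp add: powr_minus)
  qed
  define w where "w = (1 - c\<^sup>2) powr (\<beta> - 1)"
  have "((\<lambda>s. (1 - s\<^sup>2) powr (\<beta> - 1) * s powr (-1/3) - 3/2 * (1 - s\<^sup>2) powr (\<beta> - 1)) has_integral I - 3/2 * weight_mass \<beta>) {0..1}"
    by (intro has_integral_diff I has_integral_mult_right has_integral_weight) (use assms in auto)
  moreover have "((\<lambda>s::real. w * (s powr (-1/3) - 3/2)) has_integral w * (1 powr (-1/3+1) / (-1/3+1) - 3/2)) {0..1}"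
  proof (intro has_integral_mult_right has_integral_diff)
    show "((\<lambda>s::real. s powr (-1/3)) has_integral 1 powr (-1/3+1) / (-1/3+1)) {0..1}"
      by (rule has_integral_powr_from_0) auto
    show "((\<lambda>s. 3/2) has_integral (3/2::real)) {0..1::real}"
      using has_integral_const_real[of "3/2::real" 0 1] by simp
  qed
  ultimately have "I - 3/2 * weight_mass \<beta> \<le> w * (1 powr (-1/3+1) / (-1/3+1) - 3/2)"
  proof (rule has_integral_le_interior)
    fix s :: real assume s: "s \<in> {0<..<1}"
    have cs: "0 < c" "c < 1" by (auto simp: c_def)
    have "(s powr (-1/3) - 3/2) * ((1 - s\<^sup>2) powr (\<beta> - 1) - w) \<le> 0"
    proof (cases "s \<le> c")
      case True
      have "3/2 \<le> s powr (-1/3)"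
        unfolding c13[symmetric] using s True by (intro powr_mono2') auto
      moreover have "(1 - s\<^sup>2) powr (\<beta> - 1) \<le> w"
        unfolding w_def using s True assms cs weight_pos[of c]
        by (intro powr_mono2') (auto intro: power_mono)
      ultimately show ?thesis by (simp add: mult_nonneg_nonpos)
    next
      case False
      have "s powr (-1/3) \<le> 3/2"
        unfolding c13[symmetric] using s False cs by (intro powr_mono2') auto
      moreover have "w \<le> (1 - s\<^sup>2) powr (\<beta> - 1)"
        unfolding w_def using s False assms cs weight_pos[of s]
        by (intro powr_mono2') (auto intro: power_mono)
      ultimately show ?thesis by (simp add: mult_nonpos_nonneg)
    qed
    thus "(1 - s\<^sup>2) powr (\<beta> - 1) * s powr (-1/3) - 3/2 * (1 - s\<^sup>2) powr (\<beta> - 1) \<le> w * (s powr (-1/3) - 3/2)"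
      by (simp add: algebra_simps)
  qed
  hence "I \<le> 3/2 * weight_mass \<beta>" by simp
  thus ?thesis using I that by blast
qed

text \<open>In the expansion of the left side in powers of \<open>y\<close>, every coefficient after the linear one carries
  at least the factor \<open>v\<^sup>2\<close>; replacing the higher powers of \<open>v\<close> by \<open>v\<^sup>2\<close> yields the right side.
  The proof compares derivatives in \<open>y\<close>, where the claim becomes convexity of \<open>x\<^sup>-\<^sup>7\<^sup>/\<^sup>6\<close>.\<close>
lemma powr_interpolation:
  fixes v y :: real
  assumes "0 \<le> v" "v \<le> 1" "0 \<le> y" "y < 1"
  shows "(1 - v * y) powr (-1/6) \<le> 1 + (v - v\<^sup>2) * y / 6 + v\<^sup>2 * ((1 - y) powr (-1/6) - 1)"
proof -
  define h where "h = (\<lambda>c y::real. (1 - c * y) powr (-1/6))"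
  have h: "(h c has_real_derivative c * (1/6 * (1 - c * x) powr (-7/6))) (at x)" if "0 < 1 - c * x" for c x
  proof -
    have "((\<lambda>y. 1 - c * y) has_real_derivative - c) (at x)" by (auto intro!: derivative_eq_intros)
    from DERIV_chain2[where f = "\<lambda>x. x powr (-1/6)" and g = "\<lambda>y. 1 - c * y",
        OF has_real_derivative_powr[OF that] this]
    show ?thesis by (simp add: h_def mult.commute)
  qed
  let ?D = "\<lambda>y. 1 + (v - v\<^sup>2) * y / 6 + v\<^sup>2 * (h 1 y - 1) - h v y"
  have "?D 0 \<le> ?D y"
  proof (rule DERIV_nonneg_imp_nondecreasing[OF assms(3)])
    fix x :: real assume x: "0 \<le> x" "x \<le> y"
    have vx: "v * x \<le> 1 * x" using x assms by (intro mult_right_mono) auto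
    have p: "0 < 1 - v * x" "0 < 1 - x" using vx x assms by auto
    have D': "(?D has_real_derivative (v - v\<^sup>2) / 6 + v\<^sup>2 * (1/6 * (1 - x) powr (-7/6)) - v * (1/6 * (1 - v * x) powr (-7/6))) (at x)"
      using h[of 1 x] h[OF p(1)] p(2) by (auto intro!: derivative_eq_intros simp: field_simps)
    have "(1 - v * x) powr (-7/6) \<le> (1 - v) + v * (1 - x) powr (-7/6)"
    proof -
      have "1 / (1 - v * x) \<le> (1 - v) * 1 + v * (1 / (1 - x))"
      proof -
        have "0 \<le> v * (1 - v) * x\<^sup>2" using assms by simp
        hence "1 - x \<le> ((1 - v) * (1 - x) + v) * (1 - v * x)"
          by (simp add: algebra_simps power2_eq_square)
        thus ?thesis using p by (simp add: field_simps)
      qed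
      hence "(1 / (1 - v * x)) powr (7/6) \<le> ((1 - v) * 1 + v * (1 / (1 - x))) powr (7/6)"
        using p by (intro powr_mono2) auto
      also have "\<dots> \<le> (1 - v) * 1 powr (7/6) + v * (1 / (1 - x)) powr (7/6)"
        using convex_onD[OF powr_convex[of "7/6"], of v 1 "1 / (1 - x)"] assms p by simp
      finally show ?thesis using p by (simp add: powr_divide powr_minus_divide)
    qed
    hence "v * (1/6 * (1 - v * x) powr (-7/6)) \<le> v * (1/6 * ((1 - v) + v * (1 - x) powr (-7/6)))"
      using assms by (intro mult_left_mono) auto
    moreover have "v * (1/6 * ((1 - v) + v * (1 - x) powr (-7/6))) = (v - v\<^sup>2) / 6 + v\<^sup>2 * (1/6 * (1 - x) powr (-7/6))"
      by (simp add: field_simps power2_eq_square)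
    ultimately have "0 \<le> (v - v\<^sup>2) / 6 + v\<^sup>2 * (1/6 * (1 - x) powr (-7/6)) - v * (1/6 * (1 - v * x) powr (-7/6))"
      by linarith
    with D' show "\<exists>d. (?D has_real_derivative d) (at x) \<and> 0 \<le> d" by blast
  qed
  thus ?thesis by (simp add: h_def)
qed

text \<open>For \<open>\<beta> \<le> 2/3\<close> the exponent \<open>1/2 - \<beta>\<close> is at least \<open>-1/6\<close>. After the interpolation only
  the means of \<open>1 - s\<^sup>2\<close> and of \<open>s\<^sup>-\<^sup>1\<^sup>/\<^sup>3\<close> enter, bounded by \<open>4/7\<close> and \<open>3/2\<close>. The bound stays finite as \<open>v\<close> tends
  to \<open>1\<close>, where \<open>L\<close> is unbounded, and its linear coefficient is small, as it must be
  because \<open>L r\<close> agrees with \<open>(1 + r)\<^sup>2\<close> to second order.\<close>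
lemma transformed_mass_le_middle:
  assumes "1/2 \<le> \<beta>" "\<beta> \<le> 2/3" "0 \<le> v" "v < 1"
  shows "transformed_mass \<beta> v \<le> (1 + 2/21 * (v - v\<^sup>2) + 1/2 * v\<^sup>2) * weight_mass \<beta>"
proof -
  have b: "0 < \<beta>" "\<beta> \<le> 1" using assms by auto
  have vv: "0 \<le> v - v\<^sup>2" using assms by (simp add: power2_eq_square mult_left_le)
  obtain I where I: "((\<lambda>s. (1 - s\<^sup>2) powr (\<beta> - 1) * s powr (-1/3)) has_integral I) {0..1}"
    "I \<le> 3/2 * weight_mass \<beta>" using chebyshev_weight[OF assms(1) b(2)] .
  have "((\<lambda>s. (1 - v\<^sup>2) * (1 - s\<^sup>2) powr (\<beta> - 1) + (v - v\<^sup>2) / 6 * (1 - s\<^sup>2) powr (\<beta> + 1 - 1)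
        + v\<^sup>2 * ((1 - s\<^sup>2) powr (\<beta> - 1) * s powr (-1/3))) has_integral
      (1 - v\<^sup>2) * weight_mass \<beta> + (v - v\<^sup>2) / 6 * weight_mass (\<beta> + 1) + v\<^sup>2 * I) {0..1}"
    using b by (intro has_integral_add has_integral_mult_right has_integral_weight I) auto
  hence "transformed_mass \<beta> v \<le> (1 - v\<^sup>2) * weight_mass \<beta> + (v - v\<^sup>2) / 6 * weight_mass (\<beta> + 1) + v\<^sup>2 * I"
  proof (rule has_integral_le_interior[OF has_integral_transformed_mass[OF b(1) assms(3,4)]])
    fix s :: real assume s: "s \<in> {0<..<1}"
    have p: "0 < 1 - s\<^sup>2" using s weight_pos[of s] by auto
    let ?y = "1 - s\<^sup>2"
    have vy: "v * ?y \<le> 1 * ?y" using assms p by (intro mult_right_mono) auto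
    have y1: "?y < 1" using s by simp
    have z: "0 \<le> v * ?y" "v * ?y < 1" using assms p mult_strict_mono'[of v 1 ?y 1] y1 by simp_all
    have "(1 - v * ?y) powr (1/2 - \<beta>) \<le> (1 - v * ?y) powr (-1/6)"
      using assms(2) z by (intro powr_mono') linarith+
    also have "\<dots> \<le> 1 + (v - v\<^sup>2) * ?y / 6 + v\<^sup>2 * ((1 - ?y) powr (-1/6) - 1)"
      by (rule powr_interpolation) (use assms p y1 in auto)
    also have "(1 - ?y) powr (-1/6) = s powr (-1/3)"
    proof -
      have "s\<^sup>2 = s powr 2" using s by (simp add: powr_numeral)
      thus ?thesis by (simp add: powr_powr)
    qed
    finally have "?y powr (\<beta> - 1) * (1 - v * ?y) powr (1/2 - \<beta>) \<le>
       ?y powr (\<beta> - 1) * (1 + (v - v\<^sup>2) * ?y / 6 + v\<^sup>2 * (s powr (-1/3) - 1))"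
      by (rule mult_left_mono) simp
    also have "\<dots> = (1 - v\<^sup>2) * ?y powr (\<beta> - 1) + (v - v\<^sup>2) / 6 * (?y * ?y powr (\<beta> - 1)) + v\<^sup>2 * (?y powr (\<beta> - 1) * s powr (-1/3))"
      by (simp add: field_simps)
    also have "?y * ?y powr (\<beta> - 1) = ?y powr (\<beta> + 1 - 1)"
      using p powr_mult_base[of ?y "\<beta> - 1"] by simp
    finally show "?y powr (\<beta> - 1) * (1 - v * ?y) powr (1/2 - \<beta>) \<le> (1 - v\<^sup>2) * ?y powr (\<beta> - 1) + (v - v\<^sup>2) / 6 * ?y powr (\<beta> + 1 - 1)
        + v\<^sup>2 * (?y powr (\<beta> - 1) * s powr (-1/3))" .
  qed
  also have "\<dots> \<le> (1 - v\<^sup>2) * weight_mass \<beta> + (v - v\<^sup>2) / 6 * (4/7 * weight_mass \<beta>) + v\<^sup>2 * (3/2 * weight_mass \<beta>)"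
  proof (intro add_mono mult_left_mono I order_refl)
    have "2 * \<beta> / (1 + 2 * \<beta>) \<le> 4/7" using assms by (simp add: field_simps)
    thus "weight_mass (\<beta> + 1) \<le> 4/7 * weight_mass \<beta>"
      unfolding weight_mass_rec[OF b(1)] by (intro mult_right_mono weight_mass_nonneg b)
  qed (use vv assms(4) in simp_all)
  also have "\<dots> = (1 + 2/21 * (v - v\<^sup>2) + 1/2 * v\<^sup>2) * weight_mass \<beta>" by (simp add: field_simps)
  finally show ?thesis .
qed

text \<open>Seven terms of the logarithmic series are needed for the inequality to hold at \<open>r = 1\<close>.\<close>
lemma polynomial_bound:
  fixes r :: real
  assumes "0 \<le> r" "r \<le> 1"
  shows "(1 + r)\<^sup>2 * (1 + 2/21 * (r\<^sup>2 - (r\<^sup>2)\<^sup>2) + 1/2 * (r\<^sup>2)\<^sup>2) - 1/4 * (r * (1 + r)) * (1 - r\<^sup>2)\<^sup>2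
    \<le> 1 + 2 * (r + 1/2 * r^2 + 1/3 * r^3 + 1/4 * r^4 + 1/5 * r^5 + 1/6 * r^6 + 1/7 * r^7)"
    (is "?l \<le> ?u")
proof -
  define q where "q = 1 - r"
  have "?u - ?l = r * (1/4 + 13/84 * r - 1/42 * r^2 - 1/2 * r^3 - 67/420 * r^4 + 5/28 * r^5 + 2/7 * r^6)"
    by algebra
  \<comment> \<open>the Bernstein form of degree \<open>6\<close>, all of whose coefficients are positive\<close>
  also have "1/4 + 13/84 * r - 1/42 * r^2 - 1/2 * r^3 - 67/420 * r^4 + 5/28 * r^5 + 2/7 * r^6 =
     1/4 * q^6 + 139/84 * r * q^5 + 9/2 * r^2 * q^4 + 125/21 * r^3 * q^3
    + 367/105 * r^4 * q^2 + 113/210 * r^5 * q + 13/70 * r^6"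
    unfolding q_def by algebra
  also have "0 \<le> r * \<dots>" using assms by (simp add: q_def)
  finally show ?thesis by simp
qed

lemma majorant_bound_middle_exponent:
  assumes "4/3 \<le> \<alpha>" "\<alpha> \<le> 3/2" "0 \<le> r" "r < 1"
  shows "(1 - r\<^sup>2) powr \<alpha> / L r * majorant_transform \<alpha> r \<le> weight_mass (2 - \<alpha>) / 2"
proof -
  note v = r_square[OF assms(3,4)]
  define W where "W = weight_mass (2 - \<alpha>)"
  have W: "0 \<le> W" unfolding W_def by (rule weight_mass_nonneg) (use assms in auto)
  \<comment> \<open>here \<open>\<alpha> \<le> 3/2\<close> is used: the mean of \<open>1 - t\<^sup>2\<close> is at least \<open>1/2\<close>\<close>
  have w3: "W / 2 \<le> weight_mass (3 - \<alpha>)"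
  proof -
    have "1/2 \<le> 2 * (2 - \<alpha>) / (1 + 2 * (2 - \<alpha>))" using assms by (simp add: field_simps)
    hence "1/2 * W \<le> 2 * (2 - \<alpha>) / (1 + 2 * (2 - \<alpha>)) * W" using W by (rule mult_right_mono)
    also have "\<dots> = weight_mass (3 - \<alpha>)"
      using weight_mass_rec[of "2 - \<alpha>"] assms by (simp add: W_def)
    finally show ?thesis by simp
  qed
  have p: "(1 - r\<^sup>2)\<^sup>2 \<le> (1 - r\<^sup>2) powr \<alpha>"
  proof -
    have "(1 - r\<^sup>2) powr 2 \<le> (1 - r\<^sup>2) powr \<alpha>" using v assms by (intro powr_mono') auto
    thus ?thesis using v by (simp add: powr_numeral)
  qed
  have "(1 - r\<^sup>2) powr \<alpha> * majorant_transform \<alpha> r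
     \<le> (1 + r)\<^sup>2 * transformed_mass (2 - \<alpha>) (r\<^sup>2) / 2
        - r * (1 + r) * ((1 - r\<^sup>2) powr \<alpha> * weight_mass (3 - \<alpha>) / 4)"
    by (rule majorant_transform_le_refined) (use assms in auto)
  also have "\<dots> \<le> (1 + r)\<^sup>2 * ((1 + 2/21 * (r\<^sup>2 - (r\<^sup>2)\<^sup>2) + 1/2 * (r\<^sup>2)\<^sup>2) * W) / 2
        - r * (1 + r) * ((1 - r\<^sup>2)\<^sup>2 * (W / 2) / 4)"
  proof (rule diff_mono)
    have "transformed_mass (2 - \<alpha>) (r\<^sup>2) \<le> (1 + 2/21 * (r\<^sup>2 - (r\<^sup>2)\<^sup>2) + 1/2 * (r\<^sup>2)\<^sup>2) * W"
      unfolding W_def by (rule transformed_mass_le_middle) (use assms v in auto)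
    thus "(1 + r)\<^sup>2 * transformed_mass (2 - \<alpha>) (r\<^sup>2) / 2
        \<le> (1 + r)\<^sup>2 * ((1 + 2/21 * (r\<^sup>2 - (r\<^sup>2)\<^sup>2) + 1/2 * (r\<^sup>2)\<^sup>2) * W) / 2"
      by (intro divide_right_mono mult_left_mono) auto
    have "(1 - r\<^sup>2)\<^sup>2 * (W / 2) \<le> (1 - r\<^sup>2) powr \<alpha> * weight_mass (3 - \<alpha>)"
      by (rule mult_mono[OF p w3]) (use W in auto)
    thus "r * (1 + r) * ((1 - r\<^sup>2)\<^sup>2 * (W / 2) / 4)
       \<le> r * (1 + r) * ((1 - r\<^sup>2) powr \<alpha> * weight_mass (3 - \<alpha>) / 4)"
      using assms by (intro mult_left_mono divide_right_mono) auto
  qed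
  also have "\<dots> = W / 2 * ((1 + r)\<^sup>2 * (1 + 2/21 * (r\<^sup>2 - (r\<^sup>2)\<^sup>2) + 1/2 * (r\<^sup>2)\<^sup>2) - 1/4 * (r * (1 + r)) * (1 - r\<^sup>2)\<^sup>2)"
  proof -
    have "p * (h * W) / 2 - q * (u * (W / 2) / 4) = W / 2 * (p * h - 1/4 * q * u)" for p h q u :: real
      by (simp add: field_simps)
    thus ?thesis .
  qed
  also have "\<dots> \<le> W / 2 * L r"
    using polynomial_bound[of r] L_ge_poly[of r] assms W by (intro mult_left_mono) auto
  finally show ?thesis using L_pos[OF assms(3,4)] by (simp add: field_simps W_def)
qed

section \<open>The constants and their dependence on the exponent\<close>


lemma set_integral_eq_integral_unit:
  fixes f :: "real \<Rightarrow> real"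
  assumes "continuous_on {0..<1} f" "\<And>t. t \<in> {0..<1} \<Longrightarrow> 0 \<le> f t" "(f has_integral I) {0..1}"
  shows "set_integrable lborel {0..<1} f" "(LINT t:{0..<1}|lborel. f t) = I"
proof -
  have hI: "(f has_integral I) {0..<1}"
    using assms(3) by (subst has_integral_spike_set_eq[where T = "{0..1}"])
      (auto intro: negligible_subset[of "{1}"])
  have "f absolutely_integrable_on {0..<1}"
    by (intro nonnegative_absolutely_integrable_1 has_integral_integrable[OF hI] assms)
  hence "integrable (completion lborel) (\<lambda>t. indicator {0..<1} t *\<^sub>R f t)"
    by (simp add: set_integrable_def)
  moreover have "(\<lambda>t. indicator {0..<1} t *\<^sub>R f t) \<in> borel_measurable lborel"
    using borel_measurable_continuous_on_indicator[OF _ assms(1)] by simp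
  ultimately show si: "set_integrable lborel {0..<1} f"
    unfolding set_integrable_def by (subst (asm) integrable_completion)
  from set_borel_integral_eq_integral(2)[OF this] integral_unique[OF hI]
  show "(LINT t:{0..<1}|lborel. f t) = I" by simp
qed

lemma C_integrand:
  fixes t \<alpha> :: real
  assumes "0 \<le> t" "t < 1"
  shows "1 / (1 + t) * (1 - t\<^sup>2) powr (1 - \<alpha>) = (1 - t) * (1 - t\<^sup>2) powr (-\<alpha>)"
proof -
  have "(1 - t\<^sup>2) * (1 - t\<^sup>2) powr (-\<alpha>) = (1 - t\<^sup>2) powr (1 - \<alpha>)"
    using powr_mult_base[of "1 - t\<^sup>2" "-\<alpha>"] weight_pos[OF assms] by simp
  moreover have "1 - t\<^sup>2 = (1 + t) * (1 - t)" by (simp add: power2_eq_square algebra_simps)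
  ultimately show ?thesis using assms by (simp add: field_simps)
qed

lemma has_integral_C:
  assumes "1 \<le> \<alpha>" "\<alpha> < 2"
  shows "((\<lambda>t. (1 - t) * (1 - t\<^sup>2) powr (-\<alpha>)) has_integral C \<alpha>) {0..1}"
proof -
  have "(\<lambda>t. 1 / (1 + t) * (1 - t\<^sup>2) powr ((2 - \<alpha>) - 1)) integrable_on {0..1::real}"
    by (rule weight_times_integrable) (use assms in \<open>auto intro!: continuous_intros\<close>)
  then obtain I where "((\<lambda>t. 1 / (1 + t) * (1 - t\<^sup>2) powr (1 - \<alpha>)) has_integral I) {0..1}" by auto
  hence I: "((\<lambda>t. (1 - t) * (1 - t\<^sup>2) powr (-\<alpha>)) has_integral I) {0..1}"
    by (rule has_integral_spike_finite[where S = "{1}", rotated 2])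
       (use C_integrand in auto)
  have "C \<alpha> = I"
    unfolding C_def
    by (rule set_integral_eq_integral_unit(2)[OF _ _ I])
       (auto intro!: continuous_intros continuous_weight)
  thus ?thesis using I by simp
qed

lemma has_integral_majorant:
  assumes "1 \<le> \<alpha>" "\<alpha> < 2"
  shows "(majorant \<alpha> has_integral C \<alpha>) {0..1}"
proof -
  have "((\<lambda>t. 1 * majorant \<alpha> t) has_integral C \<alpha>) {0..1}"
    by (rule majorant_by_parts[where M = 1 and k = "\<lambda>t. 1 - t"])
       (use assms has_integral_C in \<open>auto intro!: continuous_intros derivative_eq_intros\<close>)
  thus ?thesis by simp
qed

lemma C_nonneg: "1 \<le> \<alpha> \<Longrightarrow> \<alpha> < 2 \<Longrightarrow> 0 \<le> C \<alpha>"
  using has_integral_nonneg[OF has_integral_majorant] by (simp add: majorant_nonneg)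

lemma C_1: "C 1 = ln 2"
proof -
  have "((\<lambda>t::real. 1 / (1 + t)) has_integral ln (1 + 1) - ln (1 + 0)) {0..1}"
    by (rule fundamental_theorem_of_calculus)
       (auto intro!: derivative_eq_intros simp flip: has_real_derivative_iff_has_vector_derivative)
  hence "((\<lambda>t. (1 - t) * (1 - t\<^sup>2) powr (-1)) has_integral ln (1 + 1) - ln (1 + 0)) {0..1::real}"
  proof (rule has_integral_spike_finite[where S = "{1}", rotated 2])
    fix t :: real assume "t \<in> {0..1} - {1}"
    thus "(1 - t) * (1 - t\<^sup>2) powr (-1) = 1 / (1 + t)"
      using C_integrand[of t 1] weight_pos[of t] by auto
  qed simp
  from has_integral_unique[OF has_integral_C[of 1] this] show ?thesis by simp
qed

text \<open>The norm of the image of \<open>F \<alpha>\<close> whenever the weighted derivative is largest at \<open>0\<close>: the first term is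
  the value of the image at \<open>0\<close> and the second its derivative there.\<close>
definition F_image_norm :: "real \<Rightarrow> real" where
  "F_image_norm \<alpha> = C \<alpha> + weight_mass (2 - \<alpha>) / 2"

text \<open>Both terms are integrals against \<open>(1 - t\<^sup>2)\<^sup>-\<^sup>\<alpha>\<close>, with factors \<open>1 - t\<close> and \<open>(1 - t\<^sup>2) / 2\<close>. In the combined
  integrand \<open>\<alpha>\<close> occurs only in the exponent.\<close>
lemma has_integral_F_image_norm:
  assumes "1 \<le> \<alpha>" "\<alpha> < 2"
  shows "((\<lambda>t. (1 - t) * (3 + t) / 2 * (1 - t\<^sup>2) powr (-\<alpha>)) has_integral F_image_norm \<alpha>) {0..1}"
proof -
  have "((\<lambda>t. (1 - t) * (1 - t\<^sup>2) powr (-\<alpha>) + 1/2 * (1 - t\<^sup>2) powr ((2 - \<alpha>) - 1)) has_integral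
      C \<alpha> + 1/2 * weight_mass (2 - \<alpha>)) {0..1}"
    by (intro has_integral_add has_integral_mult_right has_integral_weight has_integral_C) (use assms in auto)
  hence "((\<lambda>t. (1 - t) * (3 + t) / 2 * (1 - t\<^sup>2) powr (-\<alpha>)) has_integral C \<alpha> + 1/2 * weight_mass (2 - \<alpha>)) {0..1}"
  proof (rule has_integral_spike_finite[where S = "{1}", rotated 2])
    fix t :: real assume "t \<in> {0..1} - {1}"
    hence "0 < 1 - t\<^sup>2" using weight_pos[of t] by auto
    hence "(1 - t\<^sup>2) powr ((2 - \<alpha>) - 1) = (1 - t\<^sup>2) * (1 - t\<^sup>2) powr (-\<alpha>)"
      using powr_mult_base[of "1 - t\<^sup>2" "-\<alpha>"] by simp
    thus "(1 - t) * (3 + t) / 2 * (1 - t\<^sup>2) powr (-\<alpha>) =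
        (1 - t) * (1 - t\<^sup>2) powr (-\<alpha>) + 1/2 * (1 - t\<^sup>2) powr ((2 - \<alpha>) - 1)"
      by (simp add: field_simps power2_eq_square)
  qed simp
  thus ?thesis by (simp add: F_image_norm_def)
qed

text \<open>Exactly for this exponent the factor \<open>3 + t\<close> makes the integrand the derivative of
  \<open>-(3/2) (1 - t)\<^sup>2\<^sup>/\<^sup>3 (1 + t)\<^sup>-\<^sup>1\<^sup>/\<^sup>3\<close>.\<close>
lemma F_image_norm_four_thirds: "F_image_norm (4/3) = 3/2"
proof -
  let ?G = "\<lambda>t::real. - 3/2 * ((1 - t) powr (2/3) * (1 + t) powr (-1/3))"
  have "((\<lambda>t. (1 - t) * (3 + t) / 2 * (1 - t\<^sup>2) powr (-(4/3))) has_integral ?G 1 - ?G 0) {0..1}"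
  proof (rule fundamental_theorem_of_calculus_interior)
    show "continuous_on {0..1} ?G"
      by (intro continuous_intros continuous_on_powr') auto
    fix t :: real assume t: "t \<in> {0<..<1}"
    have "1 - t\<^sup>2 = (1 - t) * (1 + t)" by (simp add: power2_eq_square algebra_simps)
    hence e: "(1 - t\<^sup>2) powr (-(4/3)) = (1 - t) powr (-4/3) * (1 + t) powr (-4/3)"
      by (simp add: powr_mult)
    have a: "(1 - t) * (1 - t) powr (-4/3) = (1 - t) powr (-1/3)" "(1 - t) * (1 - t) powr (-1/3) = (1 - t) powr (2/3)"
      "(1 + t) * (1 + t) powr (-4/3) = (1 + t) powr (-1/3)"
      using t powr_mult_base[of "1 - t" "-4/3"] powr_mult_base[of "1 - t" "-1/3"] powr_mult_base[of "1 + t" "-4/3"] by auto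
    have d1: "((\<lambda>t. (1 - t) powr (2/3)) has_real_derivative - (2/3) * (1 - t) powr (-1/3)) (at t)"
      using t by (auto intro!: derivative_eq_intros)
    have d2: "((\<lambda>t. (1 + t) powr (-1/3)) has_real_derivative - (1/3) * (1 + t) powr (-4/3)) (at t)"
      using t by (auto intro!: derivative_eq_intros)
    have "(?G has_real_derivative - 3/2 * (- (2/3) * (1 - t) powr (-1/3) * (1 + t) powr (-1/3) +
        - (1/3) * (1 + t) powr (-4/3) * (1 - t) powr (2/3))) (at t)"
      by (rule DERIV_cmult[OF DERIV_mult[OF d1 d2]])
    also have "- 3/2 * (- (2/3) * (1 - t) powr (-1/3) * (1 + t) powr (-1/3) +
        - (1/3) * (1 + t) powr (-4/3) * (1 - t) powr (2/3)) = (1 - t) * (3 + t) / 2 * (1 - t\<^sup>2) powr (-(4/3))"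
      unfolding e a(2)[symmetric] a(1)[symmetric] a(3)[symmetric] by (simp add: field_simps)
    finally show "(?G has_vector_derivative (1 - t) * (3 + t) / 2 * (1 - t\<^sup>2) powr (-(4/3))) (at t)"
      by (simp add: has_real_derivative_iff_has_vector_derivative)
  qed simp
  from has_integral_unique[OF has_integral_F_image_norm[of "4/3"] this] show ?thesis by simp
qed

text \<open>The integrand increases with \<open>\<alpha>\<close>. Strictness is made quantitative:
  \<open>x\<^sup>-\<^sup>\<beta> - x\<^sup>-\<^sup>\<alpha> \<ge> (\<beta> - \<alpha>) (1 - x)\<close> for \<open>0 < x \<le> 1\<close>, so the integrals differ by at least that of
  \<open>(\<beta> - \<alpha>) t\<^sup>2 (1 - t)\<close>.\<close>
lemma F_image_norm_strict_mono:
  assumes "1 \<le> \<alpha>" "\<alpha> < \<beta>" "\<beta> < 2"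
  shows "F_image_norm \<alpha> < F_image_norm \<beta>"
proof -
  let ?G = "\<lambda>t::real. (\<beta> - \<alpha>) * (t^3/3 - t^4/4)"
  have gap: "((\<lambda>t. (\<beta> - \<alpha>) * (t\<^sup>2 * (1 - t))) has_integral ?G 1 - ?G 0) {0..1}"
  proof (rule fundamental_theorem_of_calculus)
    fix t :: real
    show "(?G has_vector_derivative (\<beta> - \<alpha>) * (t\<^sup>2 * (1 - t))) (at t within {0..1})"
      unfolding has_real_derivative_iff_has_vector_derivative[symmetric]
      by (auto intro!: derivative_eq_intros simp: eval_nat_numeral field_simps)
  qed simp
  have "F_image_norm \<alpha> + (?G 1 - ?G 0) \<le> F_image_norm \<beta>"
  proof (rule has_integral_le_interior[OF has_integral_add[OF has_integral_F_image_norm gap] has_integral_F_image_norm])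
    fix t :: real assume t: "t \<in> {0<..<1}"
    define x where "x = 1 - t\<^sup>2"
    have x: "0 < x" "x \<le> 1" using t weight_pos[of t] by (auto simp: x_def)
    have "(\<beta> - \<alpha>) * t\<^sup>2 \<le> (\<beta> - \<alpha>) * (- ln x)"
      using ln_le_minus_one[OF x(1)] assms by (intro mult_left_mono) (auto simp: x_def)
    also have "\<dots> \<le> x powr (-(\<beta> - \<alpha>)) - 1"
    proof -
      have "1 + (\<beta> - \<alpha>) * (- ln x) \<le> exp ((\<beta> - \<alpha>) * (- ln x))" by (rule exp_ge_add_one_self)
      thus ?thesis using x by (simp add: powr_def algebra_simps)
    qed
    also have "\<dots> \<le> x powr (-\<alpha>) * (x powr (-(\<beta> - \<alpha>)) - 1)"
    proof -
      have "1 \<le> x powr (-\<alpha>)" "1 \<le> x powr (-(\<beta> - \<alpha>))"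
        using x assms powr_mono'[of "-\<alpha>" 0 x] powr_mono'[of "-(\<beta> - \<alpha>)" 0 x] by auto
      from mult_right_mono[OF this(1), of "x powr (-(\<beta> - \<alpha>)) - 1"] this(2) show ?thesis by simp
    qed
    also have "\<dots> = x powr (-\<beta>) - x powr (-\<alpha>)"
    proof -
      have "x powr (-\<alpha>) * x powr (-(\<beta> - \<alpha>)) = x powr (-\<beta>)" by (simp flip: powr_add)
      thus ?thesis by (simp add: right_diff_distrib)
    qed
    finally have 1: "(\<beta> - \<alpha>) * t\<^sup>2 \<le> x powr (-\<beta>) - x powr (-\<alpha>)" .
    have 2: "1 - t \<le> (1 - t) * (3 + t) / 2"
      using mult_left_mono[of 2 "3 + t" "1 - t"] t by simp
    have "(1 - t) * ((\<beta> - \<alpha>) * t\<^sup>2) \<le> (1 - t) * (3 + t) / 2 * (x powr (-\<beta>) - x powr (-\<alpha>))"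
      by (rule mult_mono[OF 2 1]) (use t assms in auto)
    thus "(1 - t) * (3 + t) / 2 * (1 - t\<^sup>2) powr (-\<alpha>) + (\<beta> - \<alpha>) * (t\<^sup>2 * (1 - t))
        \<le> (1 - t) * (3 + t) / 2 * (1 - t\<^sup>2) powr (-\<beta>)"
      by (simp add: x_def[symmetric] field_simps)
  qed (use assms in auto)
  moreover have "0 < ?G 1 - ?G 0" using assms by simp
  ultimately show ?thesis by linarith
qed

text \<open>The substitution \<open>x = t\<^sup>2\<close> in Euler's Beta integral.\<close>
lemma weight_mass_eq_Gamma:
  assumes "0 < \<beta>"
  shows "weight_mass \<beta> = sqrt pi * Gamma \<beta> / (2 * Gamma (\<beta> + 1/2))"
proof -
  have B: "((\<lambda>x. x powr (1/2 - 1) * (1 - x) powr (\<beta> - 1)) has_integral Beta (1/2) \<beta>) {0..1}"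
    by (rule has_integral_Beta_real) (use assms in auto)
  have "((\<lambda>t. (\<lambda>x. x powr (1/2 - 1) * (1 - x) powr (\<beta> - 1)) (t\<^sup>2) * (2 * t)) has_integral Beta (1/2) \<beta>) {0..1}"
    by (rule has_integral_substitution_unit[OF B])
       (auto intro!: continuous_intros derivative_eq_intros simp: power_less_one_iff abs_square_less_1)
  hence "((\<lambda>t. 2 * (1 - t\<^sup>2) powr (\<beta> - 1)) has_integral Beta (1/2) \<beta>) {0..1}"
  proof (rule has_integral_spike_finite[where S = "{0}", rotated 2])
    fix t :: real assume "t \<in> {0..1} - {0}"
    hence t: "0 < t" by simp
    hence "t\<^sup>2 = t powr 2" by (simp add: powr_numeral)
    hence "(t\<^sup>2) powr (1/2 - 1) = t powr (-1)" by (simp add: powr_powr)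
    hence "(t\<^sup>2) powr (1/2 - 1) * t = 1" using t by (simp add: powr_minus)
    thus "2 * (1 - t\<^sup>2) powr (\<beta> - 1) = (t\<^sup>2) powr (1/2 - 1) * (1 - t\<^sup>2) powr (\<beta> - 1) * (2 * t)"
      by (simp add: mult_ac)
  qed simp
  from has_integral_unique[OF this has_integral_mult_right[OF has_integral_weight[OF assms], of 2]]
  have "2 * weight_mass \<beta> = Beta (1/2) \<beta>" by simp
  thus ?thesis by (simp add: Beta_def Gamma_one_half_real add.commute field_simps)
qed

lemma F_image_norm_eq:
  assumes "\<alpha> < 2"
  shows "F_image_norm \<alpha> = C \<alpha> + sqrt pi * Gamma (2 - \<alpha>) / (4 * Gamma (5/2 - \<alpha>))"
  using weight_mass_eq_Gamma[of "2 - \<alpha>"] assms by (simp add: F_image_norm_def algebra_simps)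

section \<open>The range below 4/3\<close>

text \<open>At \<open>\<alpha> = 1\<close> the transformed integral is elementary. With \<open>M\<close> the mean of \<open>1 / (1 - t r)\<close>,
  so that \<open>r M = - ln (1 - r)\<close> and \<open>1 \<le> M \<le> 1 / (1 - r)\<close>, the claim reduces to an inequality that is affine in
  \<open>M\<close> and therefore has to be checked only at the two ends of this range.\<close>

lemma majorant_bound_one:
  assumes "0 \<le> r" "r < 1"
  shows "(1 - r\<^sup>2) powr 1 / L r * majorant_transform 1 r \<le> 3/4"
proof -
  note v = r_square[OF assms]
  define M where "M = integral {0..1} (\<lambda>t. 1 / (1 - t * r))"
  have cM: "continuous_on {0..1} (\<lambda>t. 1 / (1 - t * r))"
    using assms by (auto intro!: continuous_intros dest: kernel_pos)
  have M: "((\<lambda>t. 1 / (1 - t * r)) has_integral M) {0..1}"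
    unfolding M_def by (intro integrable_integral integrable_continuous_real cM)
  have rM: "r * M = - ln (1 - r)"
  proof -
    have "((\<lambda>t. r * (1 / (1 - t * r))) has_integral - ln (1 - 1 * r) - (- ln (1 - 0 * r))) {0..1}"
    proof (rule fundamental_theorem_of_calculus)
      fix t :: real assume "t \<in> {0..1}"
      from kernel_pos[OF this assms]
      show "((\<lambda>t. - ln (1 - t * r)) has_vector_derivative r * (1 / (1 - t * r))) (at t within {0..1})"
        unfolding has_real_derivative_iff_has_vector_derivative[symmetric]
        by (auto intro!: derivative_eq_intros)
    qed simp
    from has_integral_unique[OF this has_integral_mult_right[OF M, of r]] show ?thesis by simp
  qed
  have M1: "1 \<le> M"
  proof (rule has_integral_le[OF _ M])
    show "((\<lambda>_. 1) has_integral (1::real)) {0..1::real}" using has_integral_const_real[of "1::real" 0 1] by simp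
    show "1 \<le> 1 / (1 - t * r)" if "t \<in> {0..1}" for t
      using kernel_pos[OF that assms] that assms by (simp add: pos_le_divide_eq)
  qed
  have M2: "M \<le> 1 / (1 - r)"
  proof (rule has_integral_le[OF M])
    show "((\<lambda>_. 1 / (1 - r)) has_integral (1 / (1 - r))) {0..1::real}"
      using has_integral_const_real[of "1 / (1 - r)" 0 1] by simp
    show "1 / (1 - t * r) \<le> 1 / (1 - r)" if "t \<in> {0..1}" for t
    proof -
      have "t * r \<le> 1 * r" using that assms by (intro mult_right_mono) auto
      thus ?thesis using assms by (intro divide_left_mono) auto
    qed
  qed
  have T: "transformed_mass 1 (r\<^sup>2) \<le> (M + 1) / 2"
  proof -
    have c2: "continuous_on {0..1} (\<lambda>t. 1 / (1 - t\<^sup>2 * r\<^sup>2))"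
      by (auto intro!: continuous_intros dest!: square_kernel_pos[OF _ zero_le_power2 v])
    define J where "J = integral {0..1} (\<lambda>t. 1 / (1 - t\<^sup>2 * r\<^sup>2))"
    have J: "((\<lambda>t. 1 / (1 - t\<^sup>2 * r\<^sup>2)) has_integral J) {0..1}"
      unfolding J_def by (intro integrable_integral integrable_continuous_real c2)
    have "((\<lambda>t. (1 - t\<^sup>2) powr (1 - 1) / (1 - t\<^sup>2 * r\<^sup>2)) has_integral J) {0..1}"
      by (rule has_integral_spike_finite[where S = "{1}", OF _ _ J])
         (use weight_pos in \<open>auto simp: less_le\<close>)
    hence "transformed_mass 1 (r\<^sup>2) = J"
      using weight_kernel_transform[of 1 "r\<^sup>2"] v
      by (simp add: transformed_mass_def integral_unique)
    moreover have "J \<le> 1/2 * (M + 1)"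
    proof (rule has_integral_le[OF J])
      show "((\<lambda>t. 1/2 * (1 / (1 - t * r) + 1)) has_integral 1/2 * (M + 1)) {0..1}"
        using has_integral_const_real[of "1::real" 0 1]
        by (intro has_integral_mult_right has_integral_add M) simp
      fix t :: real assume t: "t \<in> {0..1}"
      have p: "0 < 1 - t * r" "0 < 1 + t * r"
        using kernel_pos[OF t assms] t assms by (auto intro: add_pos_nonneg)
      have "1 - t\<^sup>2 * r\<^sup>2 = (1 - t * r) * (1 + t * r)" by (simp add: power2_eq_square algebra_simps)
      hence "1 / (1 - t\<^sup>2 * r\<^sup>2) = 1/2 * (1 / (1 - t * r) + 1 / (1 + t * r))"
        using p by (simp add: field_simps)
      also have "\<dots> \<le> 1/2 * (1 / (1 - t * r) + 1)"
        using p t assms by (intro mult_left_mono add_left_mono) auto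
      finally show "1 / (1 - t\<^sup>2 * r\<^sup>2) \<le> 1/2 * (1 / (1 - t * r) + 1)" .
    qed
    ultimately show ?thesis by simp
  qed
  \<comment> \<open>the sign of the coefficient of \<open>M\<close> decides which end of its range is extreme\<close>
  have key: "(1 + r)\<^sup>2 * (M + 1) \<le> 3 + 6 * (r * M)"
  proof (cases "(1 + r)\<^sup>2 \<le> 6 * r")
    case True
    have "((1 + r)\<^sup>2 - 6 * r) * M \<le> ((1 + r)\<^sup>2 - 6 * r) * 1"
      using True M1 by (intro mult_left_mono_neg) auto
    moreover have "2 * (1 + r)\<^sup>2 \<le> 3 + 6 * r"
      using assms mult_left_le[of r r] by (simp add: power2_eq_square algebra_simps)
    ultimately show ?thesis by (simp add: algebra_simps)
  next
    case False
    have "((1 + r)\<^sup>2 - 6 * r) * M \<le> ((1 + r)\<^sup>2 - 6 * r) * (1 / (1 - r))"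
      using False M2 by (intro mult_left_mono) auto
    moreover have "((1 + r)\<^sup>2 - 6 * r) * (1 / (1 - r)) + (1 + r)\<^sup>2 \<le> 3"
    proof -
      have "0 \<le> (1 + r) * ((1 - r) * (1 - r) + r)" using assms by simp
      hence "(1 + r)\<^sup>2 - 6 * r + (1 + r)\<^sup>2 * (1 - r) \<le> 3 * (1 - r)"
        by (simp add: power2_eq_square algebra_simps)
      thus ?thesis using assms by (simp add: field_simps)
    qed
    ultimately show ?thesis by (simp add: algebra_simps)
  qed
  have "(1 - r\<^sup>2) powr 1 * majorant_transform 1 r \<le> (1 + r)\<^sup>2 * transformed_mass 1 (r\<^sup>2) / 2"
    using majorant_transform_le[of 1 r] assms by simp
  also have "\<dots> \<le> (1 + r)\<^sup>2 * ((M + 1) / 2) / 2"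
    using T by (intro divide_right_mono mult_left_mono) auto
  also have "\<dots> \<le> 3/4 * L r" using key assms by (simp add: L_eq rM)
  finally show ?thesis using L_pos[OF assms] by (simp add: field_simps)
qed

lemma powr_convex_exponent:
  fixes q \<theta> :: real
  assumes "0 < q" "0 \<le> \<theta>" "\<theta> \<le> 1"
  shows "q powr ((1 - \<theta>) * a + \<theta> * b) \<le> (1 - \<theta>) * q powr a + \<theta> * q powr b"
  using convex_onD[OF exp_convex assms(2,3), of "a * ln q" "b * ln q"] assms(1)
  by (simp add: powr_def algebra_simps)

text \<open>The product is the integral of \<open>(w / (1 - s\<^sup>2))\<^sup>e\<close>, which is convex in the exponent \<open>e\<close> for each \<open>s\<close>.\<close>
lemma majorant_convex_exponent:
  assumes "0 \<le> \<theta>" "\<theta> \<le> 1" "0 < w" "0 \<le> t" "t < 1"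
  shows "w powr ((1 - \<theta>) * a + \<theta> * b) * majorant ((1 - \<theta>) * a + \<theta> * b) t
    \<le> (1 - \<theta>) * (w powr a * majorant a t) + \<theta> * (w powr b * majorant b t)"
proof -
  have I: "((\<lambda>s. (1 - s\<^sup>2) powr (-e)) has_integral majorant e t) {0..t}" for e
    unfolding majorant_def using weight_integrable_initial[OF assms(5)] by (rule integrable_integral)
  show ?thesis
  proof (rule has_integral_le)
    show "((\<lambda>s. w powr ((1 - \<theta>) * a + \<theta> * b) * (1 - s\<^sup>2) powr (-((1 - \<theta>) * a + \<theta> * b))) has_integral
        w powr ((1 - \<theta>) * a + \<theta> * b) * majorant ((1 - \<theta>) * a + \<theta> * b) t) {0..t}"
      by (intro has_integral_mult_right I)
    show "((\<lambda>s. (1 - \<theta>) * (w powr a * (1 - s\<^sup>2) powr (-a)) + \<theta> * (w powr b * (1 - s\<^sup>2) powr (-b))) has_integral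
       (1 - \<theta>) * (w powr a * majorant a t) + \<theta> * (w powr b * majorant b t)) {0..t}"
      by (intro has_integral_add has_integral_mult_right I)
    fix s assume "s \<in> {0..t}"
    hence p: "0 < 1 - s\<^sup>2" using weight_pos[of s] assms by auto
    have e: "w powr e * (1 - s\<^sup>2) powr (-e) = (w / (1 - s\<^sup>2)) powr e" for e
      by (simp add: powr_divide powr_minus_divide)
    show "w powr ((1 - \<theta>) * a + \<theta> * b) * (1 - s\<^sup>2) powr (-((1 - \<theta>) * a + \<theta> * b)) \<le>
       (1 - \<theta>) * (w powr a * (1 - s\<^sup>2) powr (-a)) + \<theta> * (w powr b * (1 - s\<^sup>2) powr (-b))"
      unfolding e using assms p by (intro powr_convex_exponent) auto
  qed
qed

lemma C_convex:
  assumes "0 \<le> \<theta>" "\<theta> \<le> 1" "\<alpha> = (1 - \<theta>) * 1 + \<theta> * (4/3)"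
  shows "C \<alpha> \<le> (1 - \<theta>) * C 1 + \<theta> * C (4/3)"
proof -
  have a: "1 \<le> \<alpha>" "\<alpha> < 2" using assms by auto
  show ?thesis
  proof (rule has_integral_le_interior[OF has_integral_majorant[OF a]
        has_integral_add[OF has_integral_mult_right[OF has_integral_majorant] has_integral_mult_right[OF has_integral_majorant]]])
    fix t :: real assume "t \<in> {0<..<1}"
    thus "majorant \<alpha> t \<le> (1 - \<theta>) * majorant 1 t + \<theta> * majorant (4/3) t"
      using majorant_convex_exponent[OF assms(1,2), of 1 t 1 "4/3"] assms(3) by simp
  qed auto
qed

lemma majorant_transform_convex:
  assumes "0 \<le> \<theta>" "\<theta> \<le> 1" "\<alpha> = (1 - \<theta>) * 1 + \<theta> * (4/3)" "0 \<le> r" "r < 1"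
  shows "(1 - r\<^sup>2) powr \<alpha> * majorant_transform \<alpha> r \<le>
     (1 - \<theta>) * ((1 - r\<^sup>2) powr 1 * majorant_transform 1 r) + \<theta> * ((1 - r\<^sup>2) powr (4/3) * majorant_transform (4/3) r)"
proof -
  have a: "1 \<le> \<alpha>" "\<alpha> < 2" using assms by auto
  note v = r_square[OF assms(4,5)]
  show ?thesis
  proof (rule has_integral_le_interior[OF has_integral_mult_right[OF has_integral_majorant_transform[OF a assms(4,5)]]
        has_integral_add[OF has_integral_mult_right[OF has_integral_mult_right[OF has_integral_majorant_transform]]
           has_integral_mult_right[OF has_integral_mult_right[OF has_integral_majorant_transform]]]])
    fix t :: real assume t: "t \<in> {0<..<1}"
    define K where "K = t / (1 - t * r)\<^sup>2"
    define w where "w = 1 - r\<^sup>2"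
    have K: "0 \<le> K" using t by (simp add: K_def)
    have "0 < w" using v by (simp add: w_def)
    from mult_left_mono[OF majorant_convex_exponent[OF assms(1,2) this, of t 1 "4/3"] K] t
    show "(1 - r\<^sup>2) powr \<alpha> * (t / (1 - t * r)\<^sup>2 * majorant \<alpha> t) \<le>
       (1 - \<theta>) * ((1 - r\<^sup>2) powr 1 * (t / (1 - t * r)\<^sup>2 * majorant 1 t)) +
       \<theta> * ((1 - r\<^sup>2) powr (4/3) * (t / (1 - t * r)\<^sup>2 * majorant (4/3) t))"
      unfolding assms(3)[symmetric] K_def[symmetric] w_def[symmetric] by (simp add: algebra_simps)
  qed (use assms in auto)
qed

text \<open>For \<open>\<alpha> < 4/3\<close> the number \<open>M\<close> is larger than the value at \<open>r = 0\<close>; it comes from interpolating in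
  the exponent between \<open>1\<close> and \<open>4/3\<close>, and the last inequality is strict because \<open>ln 2 < 3/4\<close>.\<close>
lemma majorant_bound:
  assumes "1 < \<alpha>" "\<alpha> < 2"
  obtains M where "\<And>r. 0 \<le> r \<Longrightarrow> r < 1 \<Longrightarrow> (1 - r\<^sup>2) powr \<alpha> / L r * majorant_transform \<alpha> r \<le> M"
    "4/3 \<le> \<alpha> \<Longrightarrow> C \<alpha> + M = F_image_norm \<alpha>" "\<alpha> < 4/3 \<Longrightarrow> C \<alpha> + M < 3/2"
proof (cases "4/3 \<le> \<alpha>")
  case True
  have "(1 - r\<^sup>2) powr \<alpha> / L r * majorant_transform \<alpha> r \<le> weight_mass (2 - \<alpha>) / 2" if "0 \<le> r" "r < 1" for r
    using majorant_bound_middle_exponent[of \<alpha> r] majorant_bound_large_exponent[of \<alpha> r] True assms that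
    by (cases "\<alpha> \<le> 3/2") auto
  thus ?thesis using True that[of "weight_mass (2 - \<alpha>) / 2"] by (auto simp: F_image_norm_def)
next
  case False
  define \<theta> where "\<theta> = 3 * (\<alpha> - 1)"
  have \<theta>: "0 \<le> \<theta>" "\<theta> < 1" "\<theta> \<le> 1" "\<alpha> = (1 - \<theta>) * 1 + \<theta> * (4/3)" using assms False by (auto simp: \<theta>_def field_simps)
  define M where "M = (1 - \<theta>) * (3/4) + \<theta> * (weight_mass (2/3) / 2)"
  show ?thesis
  proof (rule that[of M])
    fix r :: real assume r: "0 \<le> r" "r < 1"
    have 1: "(1 - r\<^sup>2) powr 1 * majorant_transform 1 r \<le> 3/4 * L r"
      using majorant_bound_one[OF r] L_pos[OF r] by (simp add: field_simps)
    have 2: "(1 - r\<^sup>2) powr (4/3) * majorant_transform (4/3) r \<le> weight_mass (2/3) / 2 * L r"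
      using majorant_bound_middle_exponent[of "4/3" r] r L_pos[OF r] by (simp add: field_simps)
    have "(1 - r\<^sup>2) powr \<alpha> * majorant_transform \<alpha> r \<le> (1 - \<theta>) * (3/4 * L r) + \<theta> * (weight_mass (2/3) / 2 * L r)"
      using majorant_transform_convex[OF \<theta>(1,3,4) r] mult_left_mono[OF 1, of "1 - \<theta>"] mult_left_mono[OF 2, of \<theta>] \<theta>
      by linarith
    also have "\<dots> = M * L r" by (simp add: M_def algebra_simps)
    finally show "(1 - r\<^sup>2) powr \<alpha> / L r * majorant_transform \<alpha> r \<le> M"
      using L_pos[OF r] by (simp add: field_simps)
  next
    have "C \<alpha> + M \<le> (1 - \<theta>) * (C 1 + 3/4) + \<theta> * F_image_norm (4/3)"
      using C_convex[OF \<theta>(1,3,4)] by (simp add: M_def F_image_norm_def algebra_simps)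
    also have "\<dots> < (1 - \<theta>) * (3/2) + \<theta> * (3/2)"
      unfolding F_image_norm_four_thirds
      using \<theta> ln2_le_25_over_36 by (intro add_less_le_mono mult_strict_left_mono) (auto simp: C_1)
    finally show "C \<alpha> + M < 3/2" by (simp add: field_simps)
  qed (use False in auto)
qed

section \<open>Bloch functions on the radius\<close>


definition bloch_seminorm :: "real \<Rightarrow> (complex \<Rightarrow> complex) \<Rightarrow> real" where
  "bloch_seminorm \<alpha> f = (SUP z\<in>ball 0 1. (1 - (norm z)\<^sup>2) powr \<alpha> * norm (deriv f z))"

lemma bloch_norm_eq: "bloch_norm \<alpha> f = norm (f 0) + bloch_seminorm \<alpha> f"
  by (simp add: bloch_norm_def bloch_seminorm_def)

lemma bloch_seminorm_upper:
  assumes "f \<in> bloch \<alpha>" "norm z < 1"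
  shows "(1 - (norm z)\<^sup>2) powr \<alpha> * norm (deriv f z) \<le> bloch_seminorm \<alpha> f"
  unfolding bloch_seminorm_def by (rule cSUP_upper) (use assms in \<open>auto simp: bloch_def\<close>)

lemma bloch_seminorm_nonneg: "f \<in> bloch \<alpha> \<Longrightarrow> 0 \<le> bloch_seminorm \<alpha> f"
  using bloch_seminorm_upper[of f \<alpha> 0] by (auto intro: order_trans[OF norm_ge_zero])

lemma bloch_deriv_le:
  assumes "f \<in> bloch \<alpha>" "norm z < 1"
  shows "norm (deriv f z) \<le> bloch_seminorm \<alpha> f * (1 - (norm z)\<^sup>2) powr (-\<alpha>)"
proof -
  have "0 < (1 - (norm z)\<^sup>2) powr \<alpha>" using weight_pos[of "norm z"] assms by simp
  thus ?thesis using bloch_seminorm_upper[OF assms] by (simp add: powr_minus_divide pos_le_divide_eq mult.commute)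
qed

lemma bloch_radial_continuous:
  assumes "f \<in> bloch \<alpha>"
  shows "continuous_on {0..<1} (\<lambda>t. f (of_real t))"
proof -
  have "continuous_on (ball 0 1) f"
    using assms by (auto simp: bloch_def intro: holomorphic_on_imp_continuous_on)
  thus ?thesis
    by (rule continuous_on_compose2) (auto intro!: continuous_intros)
qed

lemma bloch_radial_growth:
  assumes f: "f \<in> bloch \<alpha>" and t: "t \<in> {0..<1}"
  shows "norm (f (of_real t) - f 0) \<le> bloch_seminorm \<alpha> f * majorant \<alpha> t"
proof -
  have hol: "f holomorphic_on ball 0 1" using f by (simp add: bloch_def)
  have 1: "((\<lambda>s. deriv f (of_real s)) has_integral f (of_real t) - f (of_real 0)) {0..t}"
  proof (rule fundamental_theorem_of_calculus)
    fix s assume "s \<in> {0..t}"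
    hence "complex_of_real s \<in> ball 0 1" using t by simp
    hence "(f has_field_derivative deriv f (of_real s)) (at (of_real s))"
      by (rule holomorphic_derivI[OF hol open_ball])
    thus "((\<lambda>s. f (of_real s)) has_vector_derivative deriv f (of_real s)) (at s within {0..t})"
      by (rule has_vector_derivative_real_field)
  qed (use t in auto)
  have 2: "((\<lambda>s. bloch_seminorm \<alpha> f * (1 - s\<^sup>2) powr (-\<alpha>)) has_integral bloch_seminorm \<alpha> f * majorant \<alpha> t) {0..t}"
    unfolding majorant_def using t by (intro has_integral_mult_right integrable_integral weight_integrable_initial) auto
  have 3: "norm (deriv f (of_real s)) \<le> bloch_seminorm \<alpha> f * (1 - s\<^sup>2) powr (-\<alpha>)" if "s \<in> {0..t}" for s
    using bloch_deriv_le[OF f, of "of_real s"] that t by simp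
  from integral_norm_bound_integral[OF has_integral_integrable[OF 1] has_integral_integrable[OF 2] 3]
  show ?thesis unfolding integral_unique[OF 1] integral_unique[OF 2] by simp
qed

lemma bloch_radial_le:
  assumes f: "f \<in> bloch \<alpha>" and t: "t \<in> {0..<1}"
  shows "norm (f (of_real t)) \<le> norm (f 0) + bloch_seminorm \<alpha> f * majorant \<alpha> t"
  using bloch_radial_growth[OF assms] norm_triangle_ineq2[of "f (of_real t)" "f 0"] by linarith

lemma set_integrable_dominated:
  fixes h :: "real \<Rightarrow> complex"
  assumes "set_integrable lborel {0..<1} k" "continuous_on {0..<1} h" "\<And>t. t \<in> {0..<1} \<Longrightarrow> norm (h t) \<le> k t"
  shows "set_integrable lborel {0..<1} h"
proof (rule set_integrable_bound[OF assms(1)])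
  show "set_borel_measurable lborel {0..<1} h"
    using borel_measurable_continuous_on_indicator[OF _ assms(2)] by (simp add: set_borel_measurable_def)
  show "AE t in lborel. t \<in> {0..<1} \<longrightarrow> norm (h t) \<le> norm (k t)"
    using assms(3) by (auto intro: order_trans[OF _ abs_ge_self])
qed

lemma radial_bound_integral:
  assumes "1 \<le> \<alpha>" "\<alpha> < 2" "0 \<le> r" "r < 1" "0 \<le> a" "0 \<le> b"
  shows "set_integrable lborel {0..<1} (\<lambda>t. t / (1 - t * r)\<^sup>2 * (a + b * majorant \<alpha> t))"
    "(LINT t:{0..<1}|lborel. t / (1 - t * r)\<^sup>2 * (a + b * majorant \<alpha> t)) =
       a * integral {0..1} (\<lambda>t. t / (1 - t * r)\<^sup>2) + b * majorant_transform \<alpha> r"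
proof -
  have "((\<lambda>t. t / (1 - t * r)\<^sup>2) has_integral integral {0..1} (\<lambda>t. t / (1 - t * r)\<^sup>2)) {0..1}"
    by (intro integrable_integral integrable_continuous_real continuous_kernel assms)
  from has_integral_add[OF has_integral_mult_right[OF this, of a] has_integral_mult_right[OF has_integral_majorant_transform[OF assms(1-4)], of b]]
  have "((\<lambda>t. t / (1 - t * r)\<^sup>2 * (a + b * majorant \<alpha> t)) has_integral
      a * integral {0..1} (\<lambda>t. t / (1 - t * r)\<^sup>2) + b * majorant_transform \<alpha> r) {0..1}"
    by (simp only: distrib_left distrib_right mult_ac)
  moreover have "continuous_on {0..<1} (\<lambda>t. t / (1 - t * r)\<^sup>2 * (a + b * majorant \<alpha> t))"
    by (intro continuous_on_mult continuous_on_add continuous_on_const continuous_majorant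
          continuous_on_subset[OF continuous_kernel[OF assms(3,4)]]) auto
  ultimately show "set_integrable lborel {0..<1} (\<lambda>t. t / (1 - t * r)\<^sup>2 * (a + b * majorant \<alpha> t))"
    "(LINT t:{0..<1}|lborel. t / (1 - t * r)\<^sup>2 * (a + b * majorant \<alpha> t)) =
       a * integral {0..1} (\<lambda>t. t / (1 - t * r)\<^sup>2) + b * majorant_transform \<alpha> r"
    using assms majorant_nonneg by (intro set_integral_eq_integral_unit; simp)+
qed

lemma affine_majorant_integral:
  assumes "1 \<le> \<alpha>" "\<alpha> < 2" "0 \<le> a" "0 \<le> b"
  shows "((\<lambda>t. a + b * majorant \<alpha> t) has_integral a + b * C \<alpha>) {0..1}"
    "set_integrable lborel {0..<1} (\<lambda>t. a + b * majorant \<alpha> t)"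
    "(LINT t:{0..<1}|lborel. a + b * majorant \<alpha> t) = a + b * C \<alpha>"
proof -
  show *: "((\<lambda>t. a + b * majorant \<alpha> t) has_integral a + b * C \<alpha>) {0..1}"
    using has_integral_add[OF has_integral_const_real[of a 0 1] has_integral_mult_right[OF has_integral_majorant[OF assms(1,2)], of b]]
    by simp
  have c: "continuous_on {0..<1} (\<lambda>t. a + b * majorant \<alpha> t)"
    by (intro continuous_intros continuous_majorant)
  show "set_integrable lborel {0..<1} (\<lambda>t. a + b * majorant \<alpha> t)"
    "(LINT t:{0..<1}|lborel. a + b * majorant \<alpha> t) = a + b * C \<alpha>"
    using assms majorant_nonneg by (intro set_integral_eq_integral_unit[OF c _ *]; simp)+
qed

lemma complex_kernel_ge:
  fixes z :: complex
  assumes "t \<in> {0..<1}"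
  shows "1 - t * norm z \<le> norm (1 - of_real t * z)"
  using norm_triangle_ineq2[of 1 "of_real t * z"] assms by (simp add: norm_mult)

lemma complex_kernel_nonzero:
  fixes z :: complex
  assumes "t \<in> {0..<1}" "norm z < 1"
  shows "1 - of_real t * z \<noteq> 0"
proof -
  have "0 < 1 - t * norm z" using kernel_pos[of t "norm z"] assms by simp
  thus ?thesis using complex_kernel_ge[OF assms(1), of z] by auto
qed

lemma norm_le_Re_imp_real:
  assumes "norm y \<le> Re y"
  shows "y = of_real (Re y)"
proof -
  have "(norm y)\<^sup>2 \<le> (Re y)\<^sup>2" using assms by (intro power_mono) auto
  hence "Im y = 0" by (simp add: cmod_power2)
  thus ?thesis by (simp add: complex_eq_iff)
qed

section \<open>Differentiating the kernel transform\<close>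

text \<open>The Hilbert operator depends only on the restriction of a function to \<open>[0,1)\<close>. The kernel
  transform of any integrable density there is differentiated under the integral.\<close>

locale unit_interval_density =
  fixes g :: "real \<Rightarrow> complex"
  assumes g_int: "set_integrable lborel {0..<1} g" and g_cont: "continuous_on {0..<1} g"
begin

lemma times_integrable:
  assumes "continuous_on {0..<1} k" "\<And>t. t \<in> {0..<1} \<Longrightarrow> norm (k t) \<le> B"
  shows "set_integrable lborel {0..<1} (\<lambda>t. g t * k t)"
proof (rule set_integrable_dominated)
  show "set_integrable lborel {0..<1} (\<lambda>t. B * norm (g t))"
    using set_integrable_norm[OF g_int] by simp
  show "continuous_on {0..<1} (\<lambda>t. g t * k t)" by (intro continuous_intros g_cont assms)
  show "norm (g t * k t) \<le> B * norm (g t)" if "t \<in> {0..<1}" for t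
    using mult_left_mono[OF assms(2)[OF that] norm_ge_zero[of "g t"]] by (simp add: norm_mult mult.commute)
qed

lemma kernel_integrable:
  assumes "norm z < 1"
  shows "set_integrable lborel {0..<1} (\<lambda>t. g t / (1 - of_real t * z))"
    "set_integrable lborel {0..<1} (\<lambda>t. g t * (of_real t / (1 - of_real t * z)\<^sup>2))"
proof -
  have b: "1 / norm (1 - of_real t * z) \<le> 1 / (1 - norm z)" if "t \<in> {0..<1}" for t
  proof -
    have "t * norm z \<le> 1 * norm z" using that by (intro mult_right_mono) auto
    hence "1 - norm z \<le> norm (1 - of_real t * z)" using complex_kernel_ge[OF that, of z] by linarith
    thus ?thesis using assms by (intro frac_le) auto
  qed
  have "set_integrable lborel {0..<1} (\<lambda>t. g t * (1 / (1 - of_real t * z)))"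
    by (rule times_integrable[where B = "1 / (1 - norm z)"])
       (use b complex_kernel_nonzero[OF _ assms] in \<open>auto intro!: continuous_intros simp: norm_divide\<close>)
  thus "set_integrable lborel {0..<1} (\<lambda>t. g t / (1 - of_real t * z))" by simp
  show "set_integrable lborel {0..<1} (\<lambda>t. g t * (of_real t / (1 - of_real t * z)\<^sup>2))"
  proof (rule times_integrable[where B = "(1 / (1 - norm z))\<^sup>2"])
    show "continuous_on {0..<1} (\<lambda>t. complex_of_real t / (1 - of_real t * z)\<^sup>2)"
      using complex_kernel_nonzero[OF _ assms] by (auto intro!: continuous_intros)
    fix t :: real assume t: "t \<in> {0..<1}"
    have "norm (of_real t / (1 - of_real t * z)\<^sup>2) = t * (1 / norm (1 - of_real t * z))\<^sup>2"
      using t by (simp add: norm_divide norm_power power_divide)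
    also have "\<dots> \<le> 1 * (1 / (1 - norm z))\<^sup>2"
      using t b[OF t] by (intro mult_mono power_mono) auto
    finally show "norm (of_real t / (1 - of_real t * z)\<^sup>2) \<le> (1 / (1 - norm z))\<^sup>2" by simp
  qed
qed

text \<open>The remainder of the first-order expansion of \<open>1 / (1 - t w)\<close> at \<open>z\<close> is
  \<open>(w - z)\<^sup>2 t\<^sup>2 / ((1 - t w) (1 - t z)\<^sup>2)\<close>, which is uniformly \<open>O(|w - z|\<^sup>2)\<close> on a disc of radius \<open>\<rho> < 1\<close>
  around \<open>0\<close> containing \<open>z\<close>.\<close>
lemma kernel_transform_derivative:
  assumes z: "norm z < 1"
  shows "((\<lambda>z. LINT t:{0..<1}|lborel. g t / (1 - of_real t * z)) has_field_derivative
     (LINT t:{0..<1}|lborel. g t * (of_real t / (1 - of_real t * z)\<^sup>2))) (at z)"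
proof -
  define H where "H = (\<lambda>z. LINT t:{0..<1}|lborel. g t / (1 - of_real t * z))"
  define D where "D = (LINT t:{0..<1}|lborel. g t * (of_real t / (1 - of_real t * z)\<^sup>2))"
  define \<rho> where "\<rho> = (1 + norm z) / 2"
  have \<rho>: "norm z < \<rho>" "\<rho> < 1" using z by (auto simp: \<rho>_def)
  define K where "K = (LINT t:{0..<1}|lborel. norm (g t)) / (1 - \<rho>)^3"
  have est: "norm ((H w - H z) / (w - z) - D) \<le> K * norm (w - z)" if w: "norm w < \<rho>" "w \<noteq> z" for w
  proof -
    have w1: "norm w < 1" using w \<rho> by simp
    let ?R = "\<lambda>t. g t / (1 - of_real t * w) - g t / (1 - of_real t * z) - (w - z) * (g t * (of_real t / (1 - of_real t * z)\<^sup>2))"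
    note I = kernel_integrable[OF w1] kernel_integrable[OF z]
    have J: "set_integrable lborel {0..<1} (\<lambda>t. (w - z) * (g t * (of_real t / (1 - of_real t * z)\<^sup>2)))"
      by (rule set_integrable_mult_right) (rule I(4))
    have int: "set_integrable lborel {0..<1} ?R"
      by (rule set_integral_diff(1)[OF set_integral_diff(1)[OF I(1,3)] J])
    have eq: "H w - H z - (w - z) * D = (LINT t:{0..<1}|lborel. ?R t)"
      unfolding H_def D_def
      by (simp only: set_integral_diff(2)[OF set_integral_diff(1)[OF I(1,3)] J]
          set_integral_diff(2)[OF I(1,3)] set_integral_mult_right)
    have "norm (H w - H z - (w - z) * D) \<le> (LINT t:{0..<1}|lborel. norm (?R t))"
      unfolding eq by (rule set_integral_norm_bound[OF int])
    also have "\<dots> \<le> (LINT t:{0..<1}|lborel. (norm (w - z))\<^sup>2 / (1 - \<rho>)^3 * norm (g t))"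
    proof (rule set_integral_mono)
      show "set_integrable lborel {0..<1} (\<lambda>t. norm (?R t))" by (rule set_integrable_norm[OF int])
      show "set_integrable lborel {0..<1} (\<lambda>t. (norm (w - z))\<^sup>2 / (1 - \<rho>)^3 * norm (g t))"
        using set_integrable_norm[OF g_int] by simp
      fix t :: real assume t: "t \<in> {0..<1}"
      let ?p = "1 - of_real t * z" and ?q = "1 - of_real t * w"
      have nz: "?p \<noteq> 0" "?q \<noteq> 0" using complex_kernel_nonzero[OF t] z w1 by auto
      have low: "1 - \<rho> \<le> norm (1 - of_real t * u)" if "norm u < \<rho>" for u :: complex
      proof -
        have "t * norm u \<le> 1 * norm u" using t by (intro mult_right_mono) auto
        thus ?thesis using complex_kernel_ge[OF t, of u] that by linarith
      qed
      have "?R t = g t * ((w - z)\<^sup>2 * (of_real t)\<^sup>2 / (?q * ?p\<^sup>2))"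
      proof -
        have "1 / ?q - 1 / ?p - (w - z) * (of_real t / ?p\<^sup>2) = (w - z)\<^sup>2 * (of_real t)\<^sup>2 / (?q * ?p\<^sup>2)"
          using nz by (simp add: divide_simps) (simp add: algebra_simps power2_eq_square)
        hence "g t * (1 / ?q - 1 / ?p - (w - z) * (of_real t / ?p\<^sup>2)) = g t * ((w - z)\<^sup>2 * (of_real t)\<^sup>2 / (?q * ?p\<^sup>2))"
          by simp
        thus ?thesis by (simp add: algebra_simps)
      qed
      hence "norm (?R t) = norm (g t) * ((norm (w - z))\<^sup>2 * t\<^sup>2 / (norm ?q * (norm ?p)\<^sup>2))"
        using t by (simp add: norm_mult norm_divide norm_power)
      also have "\<dots> \<le> norm (g t) * ((norm (w - z))\<^sup>2 * 1 / ((1 - \<rho>) * (1 - \<rho>)\<^sup>2))"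
        using low[OF w(1)] low[OF \<rho>(1)] \<rho> t nz
        by (intro mult_left_mono frac_le mult_mono power_mono) (auto simp: power_le_one_iff)
      finally show "norm (?R t) \<le> (norm (w - z))\<^sup>2 / (1 - \<rho>)^3 * norm (g t)"
        by (simp add: power3_eq_cube power2_eq_square mult_ac)
    qed
    also have "\<dots> = K * (norm (w - z))\<^sup>2" by (simp add: K_def)
    finally have "norm (H w - H z - (w - z) * D) \<le> K * norm (w - z) * norm (w - z)"
      by (simp add: power2_eq_square)
    moreover have "(H w - H z) / (w - z) - D = (H w - H z - (w - z) * D) / (w - z)"
      using w by (simp add: field_simps)
    ultimately show ?thesis using w by (simp add: norm_divide pos_divide_le_eq)
  qed
  have "((\<lambda>w. (H w - H z) / (w - z) - D) \<longlongrightarrow> 0) (at z)"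
  proof (rule Lim_null_comparison)
    have "eventually (\<lambda>w. w \<in> ball 0 \<rho>) (nhds z)"
      using \<rho> by (intro eventually_nhds_in_open) auto
    thus "\<forall>\<^sub>F w in at z. norm ((H w - H z) / (w - z) - D) \<le> K * norm (w - z)"
      unfolding eventually_at_filter by eventually_elim (use est in auto)
    show "((\<lambda>w. K * norm (w - z)) \<longlongrightarrow> 0) (at z)"
      by (rule tendsto_eq_intros refl | simp)+
  qed
  hence "(H has_field_derivative D) (at z)"
    unfolding has_field_derivative_iff by (simp add: LIM_zero_iff)
  thus ?thesis by (simp add: H_def[abs_def] D_def)
qed

end

context
  fixes \<alpha> :: real and f :: "complex \<Rightarrow> complex"
  assumes \<alpha>: "1 < \<alpha>" "\<alpha> < 2" and f: "f \<in> bloch \<alpha>"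
begin

lemma bloch_density: "unit_interval_density (\<lambda>t. f (of_real t))"
proof
  show c: "continuous_on {0..<1} (\<lambda>t. f (of_real t))" by (rule bloch_radial_continuous[OF f])
  show "set_integrable lborel {0..<1} (\<lambda>t. f (of_real t))"
    by (rule set_integrable_dominated[OF affine_majorant_integral(2)[of \<alpha> "norm (f 0)" "bloch_seminorm \<alpha> f"] c bloch_radial_le[OF f]])
       (use \<alpha> bloch_seminorm_nonneg[OF f] in auto)
qed

interpretation d: unit_interval_density "\<lambda>t. f (of_real t)" by (rule bloch_density)

lemma hilbert_integrable:
  "norm z < 1 \<Longrightarrow> set_integrable lborel {0..<1} (\<lambda>t. f (of_real t) / (1 - of_real t * z))"
  by (rule d.kernel_integrable)

lemma hilbert_has_derivative:
  "norm z < 1 \<Longrightarrow> (hilbert_op f has_field_derivative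
     (LINT t:{0..<1}|lborel. f (of_real t) * (of_real t / (1 - of_real t * z)\<^sup>2))) (at z)"
  using d.kernel_transform_derivative unfolding hilbert_op_def[abs_def] .

lemma hilbert_holomorphic: "hilbert_op f holomorphic_on ball 0 1"
  unfolding holomorphic_on_open[OF open_ball]
  by (intro ballI exI, rule hilbert_has_derivative) simp

lemma hilbert_deriv_bound:
  assumes z: "norm z < 1"
  shows "norm (deriv (hilbert_op f) z) \<le>
     norm (f 0) * integral {0..1} (\<lambda>t. t / (1 - t * norm z)\<^sup>2) + bloch_seminorm \<alpha> f * majorant_transform \<alpha> (norm z)"
proof -
  let ?b = "bloch_seminorm \<alpha> f"
  note R = radial_bound_integral[of \<alpha> "norm z" "norm (f 0)" ?b]
  have "deriv (hilbert_op f) z = (LINT t:{0..<1}|lborel. f (of_real t) * (of_real t / (1 - of_real t * z)\<^sup>2))"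
    by (rule DERIV_imp_deriv[OF hilbert_has_derivative[OF z]])
  also have "norm \<dots> \<le> (LINT t:{0..<1}|lborel. norm (f (of_real t) * (of_real t / (1 - of_real t * z)\<^sup>2)))"
    by (rule set_integral_norm_bound[OF d.kernel_integrable(2)[OF z]])
  also have "\<dots> \<le> (LINT t:{0..<1}|lborel. t / (1 - t * norm z)\<^sup>2 * (norm (f 0) + ?b * majorant \<alpha> t))"
  proof (rule set_integral_mono)
    show "set_integrable lborel {0..<1} (\<lambda>t. norm (f (of_real t) * (of_real t / (1 - of_real t * z)\<^sup>2)))"
      by (rule set_integrable_norm[OF d.kernel_integrable(2)[OF z]])
    show "set_integrable lborel {0..<1} (\<lambda>t. t / (1 - t * norm z)\<^sup>2 * (norm (f 0) + ?b * majorant \<alpha> t))"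
      using \<alpha> z bloch_seminorm_nonneg[OF f] by (intro R) auto
    fix t :: real assume t: "t \<in> {0..<1}"
    have p: "0 < 1 - t * norm z" using kernel_pos[of t "norm z"] t z by simp
    have "norm (f (of_real t) * (of_real t / (1 - of_real t * z)\<^sup>2)) =
        t / (norm (1 - of_real t * z))\<^sup>2 * norm (f (of_real t))"
      using t by (simp add: norm_mult norm_divide norm_power)
    also have "\<dots> \<le> t / (1 - t * norm z)\<^sup>2 * (norm (f 0) + ?b * majorant \<alpha> t)"
      using t p complex_kernel_ge[OF t, of z] bloch_radial_le[OF f t]
      by (intro mult_mono frac_le power_mono) auto
    finally show "norm (f (of_real t) * (of_real t / (1 - of_real t * z)\<^sup>2)) \<le>
        t / (1 - t * norm z)\<^sup>2 * (norm (f 0) + ?b * majorant \<alpha> t)" .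
  qed
  also have "\<dots> = norm (f 0) * integral {0..1} (\<lambda>t. t / (1 - t * norm z)\<^sup>2) + ?b * majorant_transform \<alpha> (norm z)"
    using \<alpha> z bloch_seminorm_nonneg[OF f] by (intro R) auto
  finally show ?thesis .
qed

lemma hilbert_at_0: "hilbert_op f 0 = (LINT t:{0..<1}|lborel. f (of_real t))"
  by (simp add: hilbert_op_def)

lemma hilbert_at_0_le: "norm (hilbert_op f 0) \<le> norm (f 0) + bloch_seminorm \<alpha> f * C \<alpha>"
proof -
  note R = affine_majorant_integral[of \<alpha> "norm (f 0)" "bloch_seminorm \<alpha> f"]
  have "norm (hilbert_op f 0) \<le> (LINT t:{0..<1}|lborel. norm (f (of_real t)))"
    unfolding hilbert_at_0 by (rule set_integral_norm_bound[OF d.g_int])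
  also have "\<dots> \<le> (LINT t:{0..<1}|lborel. norm (f 0) + bloch_seminorm \<alpha> f * majorant \<alpha> t)"
    using \<alpha> bloch_seminorm_nonneg[OF f]
    by (intro set_integral_mono set_integrable_norm[OF d.g_int] R bloch_radial_le[OF f]) auto
  also have "\<dots> = norm (f 0) + bloch_seminorm \<alpha> f * C \<alpha>"
    using \<alpha> bloch_seminorm_nonneg[OF f] by (intro R) auto
  finally show ?thesis .
qed

text \<open>The case of equality in the triangle inequality for integrals: after multiplication by a unimodular
  constant, the real part of \<open>f\<close> is dominated by the continuous bound \<open>a + b F\<close> and has the same integral,
  so the two agree everywhere.\<close>
lemma hilbert_at_0_eq_imp:
  assumes "norm (hilbert_op f 0) = norm (f 0) + bloch_seminorm \<alpha> f * C \<alpha>"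
  obtains l where "norm l = 1" "\<And>t. t \<in> {0..<1} \<Longrightarrow> f (of_real t) = l * of_real (norm (f 0) + bloch_seminorm \<alpha> f * majorant \<alpha> t)"
proof -
  let ?m = "\<lambda>t. norm (f 0) + bloch_seminorm \<alpha> f * majorant \<alpha> t"
  define w where "w = hilbert_op f 0"
  define l where "l = (if w = 0 then 1 else sgn w)"
  have l: "norm l = 1" by (simp add: l_def norm_sgn)
  have lw: "cnj l * w = of_real (norm w)"
  proof (cases "w = 0")
    case False
    have "cnj (sgn w) * w = cnj w * w / of_real (norm w)" by (simp add: sgn_div_norm divide_inverse mult_ac scaleR_conv_of_real)
    also have "cnj w * w = of_real (norm w) * of_real (norm w)"
      by (metis complex_norm_square mult.commute of_real_mult power2_eq_square)
    finally show ?thesis using False by (simp add: l_def)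
  qed (simp add: l_def)
  have sub: "h integrable_on {0..<1} \<and> integral {0..<1} h = I" if "(h has_integral I) {0..1}" for h :: "real \<Rightarrow> real" and I
  proof -
    have "(h has_integral I) {0..<1}"
      using that by (subst has_integral_spike_set_eq[where T = "{0..1}"])
        (auto intro: negligible_subset[of "{1}"])
    thus ?thesis by (simp add: has_integral_integrable integral_unique)
  qed
  have "((\<lambda>t. f (of_real t)) has_integral w) {0..<1}"
    unfolding w_def hilbert_at_0 set_borel_integral_eq_integral(2)[OF d.g_int]
    by (rule integrable_integral[OF set_borel_integral_eq_integral(1)[OF d.g_int]])
  from has_integral_linear[OF has_integral_mult_right[OF this, of "cnj l"] bounded_linear_Re]
  have re: "((\<lambda>t. Re (cnj l * f (of_real t))) has_integral norm w) {0..<1}"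
    unfolding lw by (simp add: o_def)
  have mm: "(?m has_integral norm w) {0..<1}"
  proof -
    have "(?m has_integral norm w) {0..1}"
      unfolding w_def assms using \<alpha> bloch_seminorm_nonneg[OF f] by (intro affine_majorant_integral) auto
    from sub[OF this] show ?thesis by (metis integrable_integral)
  qed
  define u where "u = (\<lambda>t. ?m t - Re (cnj l * f (of_real t)))"
  have u0: "(u has_integral 0) {0..<1}"
    using has_integral_diff[OF mm re] by (simp add: u_def)
  have le: "Re (cnj l * f (of_real t)) \<le> norm (f (of_real t))" for t
    using complex_Re_le_cmod[of "cnj l * f (of_real t)"] l by (simp add: norm_mult)
  have upos: "0 \<le> u t" if "t \<in> {0..<1}" for t
    using le[of t] bloch_radial_le[OF f that] by (simp add: u_def)
  have ucont: "continuous_on {0..<1} u"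
    unfolding u_def by (intro continuous_intros continuous_majorant d.g_cont)
  have uz: "u t = 0" if t: "t \<in> {0..<1}" for t
  proof -
    \<comment> \<open>\<open>u\<close> need not be continuous at \<open>1\<close>, so the argument runs on compact subintervals of \<open>[0,1)\<close>\<close>
    define c where "c = (1 + t) / 2"
    have c: "0 < c" "t \<le> c" "c < 1" using t by (auto simp: c_def)
    have cc: "continuous_on {0..c} u" by (rule continuous_on_subset[OF ucont]) (use c in auto)
    have "integral {0..c} u \<le> integral {0..<1} u"
      by (rule integral_subset_le) (use c upos u0 cc integrable_continuous_real in \<open>auto simp: has_integral_integrable\<close>)
    moreover have "0 \<le> integral {0..c} u"
      by (rule integral_nonneg[OF integrable_continuous_real[OF cc]]) (use c upos in auto)
    ultimately have "integral {0..c} u = 0" using u0 by (simp add: integral_unique)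
    hence "(u has_integral 0) (cbox 0 c)"
      using integrable_integral[OF integrable_continuous_real[OF cc]] by simp
    from has_integral_0_cbox_imp_0[OF _ _ this, of t] show ?thesis
      using cc upos c t by auto
  qed
  show ?thesis
  proof (rule that[OF l])
    fix t :: real assume t: "t \<in> {0..<1}"
    let ?y = "cnj l * f (of_real t)"
    have re_y: "Re ?y = ?m t" using uz[OF t] by (simp add: u_def)
    moreover from this have "norm ?y \<le> ?m t" using bloch_radial_le[OF f t] l by (simp add: norm_mult)
    ultimately have "norm ?y \<le> Re ?y" by linarith
    hence y: "?y = of_real (Re ?y)"
      by (rule norm_le_Re_imp_real)
    have "l * ?y = l * of_real (?m t)" by (subst y, subst re_y) (rule refl)
    moreover have "l * cnj l = 1" using l by (simp add: complex_norm_square[symmetric])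
    ultimately show "f (of_real t) = l * of_real (?m t)" by (simp add: mult.assoc[symmetric])
  qed
qed

end

section \<open>The extremal functions\<close>


lemma extremal_base:
  fixes z :: complex
  assumes "norm z < 1"
  shows "0 < 1 - (norm z)\<^sup>2" "1 - (norm z)\<^sup>2 \<le> norm (1 - z\<^sup>2)" "1 - z\<^sup>2 \<notin> \<real>\<^sub>\<le>\<^sub>0"
proof -
  show p: "0 < 1 - (norm z)\<^sup>2" using weight_pos[of "norm z"] assms by simp
  show "1 - (norm z)\<^sup>2 \<le> norm (1 - z\<^sup>2)"
    using norm_triangle_ineq2[of 1 "z\<^sup>2"] by (simp add: norm_power)
  have "Re (z\<^sup>2) \<le> (norm z)\<^sup>2" using complex_Re_le_cmod[of "z\<^sup>2"] by (simp only: norm_power)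
  hence "0 < Re (1 - z\<^sup>2)" unfolding minus_complex.sel using p by simp
  thus "1 - z\<^sup>2 \<notin> \<real>\<^sub>\<le>\<^sub>0" unfolding complex_nonpos_Reals_iff by linarith
qed

lemma F_has_derivative:
  assumes z: "norm z < 1"
  shows "(F \<alpha> has_field_derivative (1 - z\<^sup>2) powr (- of_real \<alpha>)) (at z)"
proof -
  let ?p = "\<lambda>z::complex. (1 - z\<^sup>2) powr (- of_real \<alpha>)"
  have "?p holomorphic_on ball 0 1"
    by (intro holomorphic_intros) (use extremal_base(3) in auto)
  then obtain G where G: "\<And>z. z \<in> ball 0 1 \<Longrightarrow> (G has_field_derivative ?p z) (at z within ball 0 1)"
    using holomorphic_convex_primitive'[OF convex_ball open_ball] by metis
  have F: "F \<alpha> z = G z - G 0" if z: "norm z < 1" for z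
  proof -
    have "path_image (linepath 0 z) \<subseteq> ball 0 1"
      unfolding path_image_linepath using z by (intro closed_segment_subset) auto
    from contour_integral_primitive[OF G _ this]
    have "(?p has_contour_integral (G z - G 0)) (linepath 0 z)" by simp
    thus ?thesis unfolding F_def by (rule contour_integral_unique)
  qed
  show ?thesis
  proof (rule has_field_derivative_transform_within_open[OF _ open_ball])
    have "(G has_field_derivative ?p z) (at z)"
      using G[of z] z by (simp add: at_within_open[OF _ open_ball])
    thus "((\<lambda>z. G z - G 0) has_field_derivative ?p z) (at z)"
      by (auto intro!: derivative_eq_intros)
    show "z \<in> ball 0 1" using z by simp
  qed (use F in auto)
qed

lemma F_0 [simp]: "F \<alpha> 0 = 0"
  by (simp add: F_def)

lemma F_real:
  assumes t: "t \<in> {0..<1}"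
  shows "F \<alpha> (of_real t) = of_real (majorant \<alpha> t)"
proof -
  have "((\<lambda>s. (1 - (complex_of_real s)\<^sup>2) powr (- of_real \<alpha>)) has_integral F \<alpha> (of_real t) - F \<alpha> (of_real 0)) {0..t}"
  proof (rule fundamental_theorem_of_calculus)
    fix s assume "s \<in> {0..t}"
    thus "((\<lambda>s. F \<alpha> (of_real s)) has_vector_derivative (1 - (complex_of_real s)\<^sup>2) powr (- of_real \<alpha>)) (at s within {0..t})"
      using t by (intro has_vector_derivative_real_field F_has_derivative) auto
  qed (use t in auto)
  moreover have "((\<lambda>s. (1 - (complex_of_real s)\<^sup>2) powr (- of_real \<alpha>)) has_integral of_real (majorant \<alpha> t)) {0..t}"
  proof (rule has_integral_eq)
    show "((\<lambda>s. complex_of_real ((1 - s\<^sup>2) powr (-\<alpha>))) has_integral of_real (majorant \<alpha> t)) {0..t}"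
      unfolding majorant_def using t
      by (intro has_integral_of_real integrable_integral weight_integrable_initial) auto
    fix s assume "s \<in> {0..t}"
    hence "0 \<le> 1 - s\<^sup>2" using weight_pos[of s] t by simp
    from powr_of_real[OF this, of "-\<alpha>"]
    show "complex_of_real ((1 - s\<^sup>2) powr (-\<alpha>)) = (1 - (complex_of_real s)\<^sup>2) powr (- of_real \<alpha>)" by simp
  qed
  ultimately show ?thesis by (auto dest: has_integral_unique)
qed

definition extremal :: "real \<Rightarrow> complex \<Rightarrow> real \<Rightarrow> complex \<Rightarrow> complex" where
  "extremal \<alpha> l a z = l * (of_real a + (1 - of_real a) * F \<alpha> z)"

lemma extremal_has_derivative:
  assumes "norm z < 1"
  shows "(extremal \<alpha> l a has_field_derivative l * ((1 - of_real a) * (1 - z\<^sup>2) powr (- of_real \<alpha>))) (at z)"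
  unfolding extremal_def[abs_def]
  by (auto intro!: derivative_eq_intros F_has_derivative assms)

lemma extremal_holomorphic: "extremal \<alpha> l a holomorphic_on ball 0 1"
  unfolding holomorphic_on_open[OF open_ball]
  by (intro ballI exI, rule extremal_has_derivative) simp

lemma extremal_real:
  "t \<in> {0..<1} \<Longrightarrow> extremal \<alpha> l a (of_real t) = l * of_real (a + (1 - a) * majorant \<alpha> t)"
  by (simp add: extremal_def F_real)

context
  fixes \<alpha> :: real and f :: "complex \<Rightarrow> complex" and l :: complex and a :: real
  assumes \<alpha>: "1 < \<alpha>" "\<alpha> < 2" and l: "norm l = 1" and a: "0 \<le> a" "a \<le> 1"
    and f: "\<And>z. z \<in> ball 0 1 \<Longrightarrow> f z = extremal \<alpha> l a z"
begin

lemma extremal_deriv: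
  assumes "norm z < 1"
  shows "norm (deriv f z) = (1 - a) * norm (1 - z\<^sup>2) powr (-\<alpha>)"
proof -
  have "(f has_field_derivative l * ((1 - of_real a) * (1 - z\<^sup>2) powr (- of_real \<alpha>))) (at z)"
    by (rule has_field_derivative_transform_within_open[where S = "ball 0 1", OF extremal_has_derivative[OF assms] open_ball])
       (use assms f in auto)
  hence "deriv f z = l * (of_real (1 - a) * (1 - z\<^sup>2) powr (of_real (-\<alpha>)))" by (simp add: DERIV_imp_deriv)
  thus ?thesis using l a by (simp add: norm_mult norm_powr_real_powr' del: of_real_diff of_real_minus)
qed

text \<open>Here \<open>1 - |z|\<^sup>2 \<le> |1 - z\<^sup>2|\<close>, with equality at \<open>0\<close>.\<close>
lemma extremal_deriv_le:
  assumes "norm z < 1"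
  shows "(1 - (norm z)\<^sup>2) powr \<alpha> * norm (deriv f z) \<le> 1 - a"
proof -
  note b = extremal_base[OF assms]
  have "(1 - (norm z)\<^sup>2) powr \<alpha> \<le> norm (1 - z\<^sup>2) powr \<alpha>"
    using b \<alpha> by (intro powr_mono2) auto
  hence "(1 - (norm z)\<^sup>2) powr \<alpha> * norm (1 - z\<^sup>2) powr (-\<alpha>) \<le> 1"
    using b by (simp add: powr_minus_divide divide_le_eq_1)
  from mult_left_mono[OF this, of "1 - a"] a show ?thesis
    unfolding extremal_deriv[OF assms] by (simp add: mult_ac)
qed

lemma extremal_bloch: "f \<in> bloch \<alpha>"
proof -
  have "f holomorphic_on ball 0 1"
    using extremal_holomorphic by (rule holomorphic_transform) (use f in auto)
  moreover have "bdd_above ((\<lambda>z. (1 - (norm z)\<^sup>2) powr \<alpha> * norm (deriv f z)) ` ball 0 1)"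
    using extremal_deriv_le by (intro bdd_aboveI2[where M = "1 - a"]) auto
  ultimately show ?thesis by (simp add: bloch_def)
qed

lemma extremal_at_0: "norm (f 0) = a"
  using f[of 0] extremal_real[of 0 \<alpha> l a] l a by (simp add: norm_mult)

lemma extremal_seminorm: "bloch_seminorm \<alpha> f = 1 - a"
proof (rule antisym)
  show "bloch_seminorm \<alpha> f \<le> 1 - a"
    unfolding bloch_seminorm_def by (rule cSUP_least) (use extremal_deriv_le in auto)
  show "1 - a \<le> bloch_seminorm \<alpha> f"
    using bloch_seminorm_upper[OF extremal_bloch, of 0] extremal_deriv[of 0] by simp
qed

lemma extremal_norm: "bloch_norm \<alpha> f = 1"
  by (simp add: bloch_norm_eq extremal_at_0 extremal_seminorm)

lemma extremal_hilbert_at_0: "norm (hilbert_op f 0) = a + (1 - a) * C \<alpha>"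
proof -
  have "hilbert_op f 0 = (LINT t:{0..<1}|lborel. l * of_real (a + (1 - a) * majorant \<alpha> t))"
    unfolding hilbert_op_def by (rule set_lebesgue_integral_cong) (use f extremal_real in auto)
  also have "\<dots> = l * of_real (LINT t:{0..<1}|lborel. a + (1 - a) * majorant \<alpha> t)"
    by (simp only: set_integral_mult_right set_integral_complex_of_real)
  also have "(LINT t:{0..<1}|lborel. a + (1 - a) * majorant \<alpha> t) = a + (1 - a) * C \<alpha>"
    by (rule affine_majorant_integral) (use \<alpha> a in auto)
  finally show ?thesis using l a C_nonneg[of \<alpha>] \<alpha> by (simp add: norm_mult del: of_real_add of_real_mult)
qed

lemma extremal_hilbert_deriv_0:
  "norm (deriv (hilbert_op f) 0) = a / 2 + (1 - a) * (weight_mass (2 - \<alpha>) / 2)"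
proof -
  have t: "integral {0..1} (\<lambda>t. t / (1 - t * 0)\<^sup>2) = (1/2 :: real)"
    using ident_has_integral[of 0 "1::real"] by (simp add: integral_unique)
  have m: "majorant_transform \<alpha> 0 = weight_mass (2 - \<alpha>) / 2"
    using majorant_moment[of \<alpha>] \<alpha> by (simp add: majorant_transform_def integral_unique)
  have "deriv (hilbert_op f) 0 = (LINT t:{0..<1}|lborel. f (of_real t) * (of_real t / (1 - of_real t * 0)\<^sup>2))"
    by (rule DERIV_imp_deriv[OF hilbert_has_derivative[OF \<alpha> extremal_bloch]]) simp
  also have "\<dots> = (LINT t:{0..<1}|lborel. l * of_real (t / (1 - t * 0)\<^sup>2 * (a + (1 - a) * majorant \<alpha> t)))"
    by (rule set_lebesgue_integral_cong) (use f extremal_real in auto)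
  also have "\<dots> = l * of_real (LINT t:{0..<1}|lborel. t / (1 - t * 0)\<^sup>2 * (a + (1 - a) * majorant \<alpha> t))"
    by (simp only: set_integral_mult_right set_integral_complex_of_real)
  also have "(LINT t:{0..<1}|lborel. t / (1 - t * 0)\<^sup>2 * (a + (1 - a) * majorant \<alpha> t)) =
     a * integral {0..1} (\<lambda>t. t / (1 - t * 0)\<^sup>2) + (1 - a) * majorant_transform \<alpha> 0"
    by (rule radial_bound_integral) (use \<alpha> a in auto)
  also have "\<dots> = a / 2 + (1 - a) * (weight_mass (2 - \<alpha>) / 2)" unfolding t m by simp
  finally show ?thesis
    using l a weight_mass_nonneg[of "2 - \<alpha>"] \<alpha> by (simp add: norm_mult del: of_real_add of_real_mult of_real_divide)
qed

end

section \<open>The operator norm and the norm-attaining functions\<close>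


lemma hilbert_weighted_deriv_le:
  assumes \<alpha>: "1 < \<alpha>" "\<alpha> < 2" and f: "f \<in> bloch \<alpha>"
    and M: "\<And>r. 0 \<le> r \<Longrightarrow> r < 1 \<Longrightarrow> (1 - r\<^sup>2) powr \<alpha> / L r * majorant_transform \<alpha> r \<le> M"
    and z: "norm z < 1"
  shows "(1 - (norm z)\<^sup>2) powr \<alpha> / L (norm z) * norm (deriv (hilbert_op f) z) \<le> norm (f 0) / 2 + bloch_seminorm \<alpha> f * M"
proof -
  let ?w = "(1 - (norm z)\<^sup>2) powr \<alpha> / L (norm z)"
  let ?A = "integral {0..1} (\<lambda>t. t / (1 - t * norm z)\<^sup>2)"
  have "0 \<le> ?w" using L_pos[of "norm z"] z by simp
  hence "?w * norm (deriv (hilbert_op f) z) \<le>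
      ?w * (norm (f 0) * ?A + bloch_seminorm \<alpha> f * majorant_transform \<alpha> (norm z))"
    by (intro mult_left_mono hilbert_deriv_bound[OF \<alpha> f z])
  also have "\<dots> = norm (f 0) * (?w * ?A) + bloch_seminorm \<alpha> f * (?w * majorant_transform \<alpha> (norm z))"
    by (simp only: distrib_left mult_ac)
  also have "\<dots> \<le> norm (f 0) * (1/2) + bloch_seminorm \<alpha> f * M"
    using z \<alpha> by (intro add_mono mult_left_mono constant_term_bound M bloch_seminorm_nonneg[OF f]) auto
  finally show ?thesis by simp
qed

lemma hilbert_log_bloch:
  assumes \<alpha>: "1 < \<alpha>" "\<alpha> < 2" and f: "f \<in> bloch \<alpha>"
  shows "hilbert_op f \<in> log_bloch \<alpha>"
proof -
  obtain M where M: "\<And>r. 0 \<le> r \<Longrightarrow> r < 1 \<Longrightarrow> (1 - r\<^sup>2) powr \<alpha> / L r * majorant_transform \<alpha> r \<le> M"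
    using majorant_bound[OF \<alpha>] by metis
  have "bdd_above ((\<lambda>z. (1 - (norm z)\<^sup>2) powr \<alpha> / L (norm z) * norm (deriv (hilbert_op f) z)) ` ball 0 1)"
    using hilbert_weighted_deriv_le[OF \<alpha> f M] by (intro bdd_aboveI2) auto
  thus ?thesis using hilbert_holomorphic[OF \<alpha> f] by (simp add: log_bloch_def)
qed

lemma hilbert_log_norm_le:
  assumes \<alpha>: "1 < \<alpha>" "\<alpha> < 2" and f: "f \<in> bloch \<alpha>"
    and M: "\<And>r. 0 \<le> r \<Longrightarrow> r < 1 \<Longrightarrow> (1 - r\<^sup>2) powr \<alpha> / L r * majorant_transform \<alpha> r \<le> M"
  shows "log_bloch_norm \<alpha> (hilbert_op f) \<le> norm (hilbert_op f 0) + norm (f 0) / 2 + bloch_seminorm \<alpha> f * M"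
proof -
  have "(SUP z\<in>ball 0 1. (1 - (norm z)\<^sup>2) powr \<alpha> / L (norm z) * norm (deriv (hilbert_op f) z))
      \<le> norm (f 0) / 2 + bloch_seminorm \<alpha> f * M"
    by (rule cSUP_least) (use hilbert_weighted_deriv_le[OF \<alpha> f M] in auto)
  thus ?thesis by (simp add: log_bloch_norm_def)
qed

lemma log_norm_ge_at_0:
  assumes "g \<in> log_bloch \<alpha>"
  shows "norm (g 0) + norm (deriv g 0) \<le> log_bloch_norm \<alpha> g"
proof -
  have "(1 - (norm (0::complex))\<^sup>2) powr \<alpha> / L (norm (0::complex)) * norm (deriv g 0) \<le>
     (SUP z\<in>ball 0 1. (1 - (norm z)\<^sup>2) powr \<alpha> / L (norm z) * norm (deriv g z))"
    by (rule cSUP_upper) (use assms in \<open>auto simp: log_bloch_def\<close>)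
  thus ?thesis by (simp add: log_bloch_norm_def L_def)
qed

lemma extremal_log_norm_ge:
  assumes "1 < \<alpha>" "\<alpha> < 2" "norm l = 1" "0 \<le> a" "a \<le> 1" "\<And>z. z \<in> ball 0 1 \<Longrightarrow> f z = extremal \<alpha> l a z"
  shows "a * (3/2) + (1 - a) * F_image_norm \<alpha> \<le> log_bloch_norm \<alpha> (hilbert_op f)"
  using log_norm_ge_at_0[OF hilbert_log_bloch[OF assms(1,2) extremal_bloch[OF assms]]]
    extremal_hilbert_at_0[OF assms] extremal_hilbert_deriv_0[OF assms]
  by (simp add: F_image_norm_def algebra_simps)

text \<open>Equality at \<open>0\<close> fixes \<open>f\<close> on \<open>[0,1)\<close>, a set that accumulates inside the disc, so the identity
  theorem applies.\<close>
lemma equality_imp_extremal: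
  assumes \<alpha>: "1 < \<alpha>" "\<alpha> < 2" and f: "f \<in> bloch \<alpha>" "bloch_norm \<alpha> f = 1"
    and eq: "norm (hilbert_op f 0) = norm (f 0) + bloch_seminorm \<alpha> f * C \<alpha>"
  obtains l where "norm l = 1" "\<And>z. z \<in> ball 0 1 \<Longrightarrow> f z = extremal \<alpha> l (norm (f 0)) z"
proof -
  obtain l where l: "norm l = 1"
    "\<And>t. t \<in> {0..<1} \<Longrightarrow> f (of_real t) = l * of_real (norm (f 0) + bloch_seminorm \<alpha> f * majorant \<alpha> t)"
    using hilbert_at_0_eq_imp[OF \<alpha> f(1) eq] by metis
  have b: "bloch_seminorm \<alpha> f = 1 - norm (f 0)" using f(2) by (simp add: bloch_norm_eq)
  let ?h = "\<lambda>z. f z - extremal \<alpha> l (norm (f 0)) z"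
  have hol: "?h holomorphic_on ball 0 1"
    using f(1) by (intro holomorphic_on_diff extremal_holomorphic) (simp add: bloch_def)
  have lim: "0 islimpt (complex_of_real ` {0..<1})"
  proof (rule islimptI)
    fix T :: "complex set" assume "0 \<in> T" "open T"
    then obtain e where e: "0 < e" "ball 0 e \<subseteq> T" by (auto simp: open_contains_ball)
    define x where "x = min (e/2) (1/2)"
    have "0 < x" "x < e" "x < 1" using e by (auto simp: x_def)
    thus "\<exists>y\<in>complex_of_real ` {0..<1}. y \<in> T \<and> y \<noteq> 0"
      using e by (intro bexI[of _ "of_real x"]) auto
  qed
  have "f z = extremal \<alpha> l (norm (f 0)) z" if "z \<in> ball 0 1" for z
  proof -
    have "?h z = 0"
    proof (rule analytic_continuation[OF hol open_ball connected_ball _ _ lim _ that])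
      show "complex_of_real ` {0..<1} \<subseteq> ball 0 1" by auto
      show "?h y = 0" if "y \<in> complex_of_real ` {0..<1}" for y
        using that l(2) extremal_real[of _ \<alpha> l "norm (f 0)"] b by auto
    qed simp
    thus ?thesis by simp
  qed
  with l(1) show ?thesis using that by blast
qed

text \<open>The upper bound is affine in \<open>a = |f 0|\<close> on functions of norm one. A norm-attaining function must satisfy
  every inequality with equality, in particular the one for \<open>|Hf(0)|\<close>, and \<open>a\<close> must maximise the affine
  function. The parameter \<open>N\<close> names the larger of the two endpoint values.\<close>
lemma norm_attaining_iff:
  assumes \<alpha>: "1 < \<alpha>" "\<alpha> < 2" and N: "N = (if \<alpha> \<le> 4/3 then 3/2 else F_image_norm \<alpha>)"
  shows "hilbert_op_norm \<alpha> = N"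
    and "\<exists>K. \<forall>f\<in>bloch \<alpha>. log_bloch_norm \<alpha> (hilbert_op f) \<le> K * bloch_norm \<alpha> f"
    and "f \<in> norm_attaining \<alpha> \<longleftrightarrow> (\<exists>l a. norm l = 1 \<and> 0 \<le> a \<and> a \<le> 1 \<and>
       a * (3/2) + (1 - a) * F_image_norm \<alpha> = N \<and> (\<forall>z\<in>ball 0 1. f z = extremal \<alpha> l a z))"
proof -
  obtain M where M: "\<And>r. 0 \<le> r \<Longrightarrow> r < 1 \<Longrightarrow> (1 - r\<^sup>2) powr \<alpha> / L r * majorant_transform \<alpha> r \<le> M"
    and M1: "4/3 \<le> \<alpha> \<Longrightarrow> C \<alpha> + M = F_image_norm \<alpha>" and M2: "\<alpha> < 4/3 \<Longrightarrow> C \<alpha> + M < 3/2"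
    using majorant_bound[OF \<alpha>] by metis
  have tot: "\<alpha> < 4/3 \<Longrightarrow> F_image_norm \<alpha> < 3/2" "4/3 < \<alpha> \<Longrightarrow> 3/2 < F_image_norm \<alpha>"
    using F_image_norm_strict_mono[of \<alpha> "4/3"] F_image_norm_strict_mono[of "4/3" \<alpha>] F_image_norm_four_thirds \<alpha> by auto
  have tot_eq: "F_image_norm \<alpha> = 3/2" if "\<alpha> = 4/3" unfolding that by (rule F_image_norm_four_thirds)
  have CM: "C \<alpha> + M \<le> N" and N32: "3/2 \<le> N"
    using M1 M2 tot tot_eq by (cases \<alpha> "4/3::real" rule: linorder_cases; simp add: N)+
  have split: "norm (f 0) * (3/2) + bloch_seminorm \<alpha> f * (C \<alpha> + M) \<le> N * bloch_norm \<alpha> f" if "f \<in> bloch \<alpha>" for f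
    using mult_left_mono[OF N32 norm_ge_zero[of "f 0"]] mult_left_mono[OF CM bloch_seminorm_nonneg[OF that]]
    by (simp add: bloch_norm_eq algebra_simps)
  have upper: "log_bloch_norm \<alpha> (hilbert_op f) \<le> norm (f 0) * (3/2) + bloch_seminorm \<alpha> f * (C \<alpha> + M)"
    if "f \<in> bloch \<alpha>" for f
    using hilbert_log_norm_le[OF \<alpha> that M] hilbert_at_0_le[OF \<alpha> that] by (simp add: algebra_simps)
  show "\<exists>K. \<forall>f\<in>bloch \<alpha>. log_bloch_norm \<alpha> (hilbert_op f) \<le> K * bloch_norm \<alpha> f"
    using upper split by (intro exI[of _ N] ballI) (metis order_trans)
  have unit: "log_bloch_norm \<alpha> (hilbert_op f) \<le> N" if "f \<in> bloch \<alpha>" "bloch_norm \<alpha> f \<le> 1" for f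
  proof -
    have "N * bloch_norm \<alpha> f \<le> N * 1" using that N32 by (intro mult_left_mono) auto
    thus ?thesis using upper[OF that(1)] split[OF that(1)] by linarith
  qed
  have ext: "f \<in> bloch \<alpha> \<and> bloch_norm \<alpha> f = 1 \<and> log_bloch_norm \<alpha> (hilbert_op f) = N"
    if "norm l = 1" "0 \<le> a" "a \<le> 1" "a * (3/2) + (1 - a) * F_image_norm \<alpha> = N" "\<And>z. z \<in> ball 0 1 \<Longrightarrow> f z = extremal \<alpha> l a z"
    for f l a
  proof -
    note E = \<alpha> that(1-3,5)
    show ?thesis
      using extremal_bloch[OF E] extremal_norm[OF E] extremal_log_norm_ge[OF E] that(4) unit[OF extremal_bloch[OF E]]
      by auto
  qed
  \<comment> \<open>the end of \<open>[0,1]\<close> at which the affine function of \<open>a\<close> is largest\<close>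
  define a0 where "a0 = (if \<alpha> \<le> 4/3 then 1 else 0 :: real)"
  have a0: "0 \<le> a0" "a0 \<le> 1" "a0 * (3/2) + (1 - a0) * F_image_norm \<alpha> = N" by (auto simp: a0_def N)
  note e0 = ext[OF norm_one a0 refl]
  show norm: "hilbert_op_norm \<alpha> = N"
    unfolding hilbert_op_norm_def
  proof (rule cSup_eq_maximum)
    show "N \<in> (\<lambda>f. log_bloch_norm \<alpha> (hilbert_op f)) ` {f \<in> bloch \<alpha>. bloch_norm \<alpha> f \<le> 1}"
      using e0 by (intro image_eqI[of _ _ "extremal \<alpha> 1 a0"]) auto
  qed (use unit in auto)
  show "f \<in> norm_attaining \<alpha> \<longleftrightarrow> (\<exists>l a. norm l = 1 \<and> 0 \<le> a \<and> a \<le> 1 \<and>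
       a * (3/2) + (1 - a) * F_image_norm \<alpha> = N \<and> (\<forall>z\<in>ball 0 1. f z = extremal \<alpha> l a z))"
  proof
    assume "f \<in> norm_attaining \<alpha>"
    hence f: "f \<in> bloch \<alpha>" "bloch_norm \<alpha> f = 1" "log_bloch_norm \<alpha> (hilbert_op f) = N"
      by (auto simp: norm_attaining_def norm)
    let ?a = "norm (f 0)"
    have b: "bloch_seminorm \<alpha> f = 1 - ?a" using f(2) by (simp add: bloch_norm_eq)
    have a: "0 \<le> ?a" "?a \<le> 1" using bloch_seminorm_nonneg[OF f(1)] b by auto
    have val: "?a * (3/2) + (1 - ?a) * (C \<alpha> + M) = N"
      using upper[OF f(1)] split[OF f(1)] f b by simp
    have "norm (hilbert_op f 0) = ?a + bloch_seminorm \<alpha> f * C \<alpha>"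
      using hilbert_log_norm_le[OF \<alpha> f(1) M] hilbert_at_0_le[OF \<alpha> f(1)] val f(3) unfolding b
      by (simp add: algebra_simps)
    then obtain l where l: "norm l = 1" "\<And>z. z \<in> ball 0 1 \<Longrightarrow> f z = extremal \<alpha> l ?a z"
      using equality_imp_extremal[OF \<alpha> f(1,2)] by metis
    have "?a * (3/2) + (1 - ?a) * F_image_norm \<alpha> = N"
    proof (cases "4/3 \<le> \<alpha>")
      case True
      thus ?thesis using val M1 by simp
    next
      case False
      hence "(1 - ?a) * (3/2 - (C \<alpha> + M)) = 0" using val by (simp add: N field_simps)
      hence "?a = 1" using M2 False by simp
      thus ?thesis using False by (simp add: N)
    qed
    thus "\<exists>l a. norm l = 1 \<and> 0 \<le> a \<and> a \<le> 1 \<and>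
       a * (3/2) + (1 - a) * F_image_norm \<alpha> = N \<and> (\<forall>z\<in>ball 0 1. f z = extremal \<alpha> l a z)"
      using l a by blast
  next
    assume "\<exists>l a. norm l = 1 \<and> 0 \<le> a \<and> a \<le> 1 \<and>
       a * (3/2) + (1 - a) * F_image_norm \<alpha> = N \<and> (\<forall>z\<in>ball 0 1. f z = extremal \<alpha> l a z)"
    then obtain l a where "norm l = 1" "0 \<le> a" "a \<le> 1" "a * (3/2) + (1 - a) * F_image_norm \<alpha> = N"
      "\<And>z. z \<in> ball 0 1 \<Longrightarrow> f z = extremal \<alpha> l a z" by blast
    from ext[OF this] show "f \<in> norm_attaining \<alpha>" by (simp add: norm_attaining_def norm)
  qed
qed

theorem theorem1p2:
  fixes \<alpha> :: real
  assumes "1 < \<alpha>" and "\<alpha> < 2"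
  shows "(\<forall>f\<in>bloch \<alpha>. \<forall>z\<in>ball 0 1.
            set_integrable lborel {0..<1} (\<lambda>t::real. f (of_real t) / (1 - of_real t * z)))
    \<and> (\<forall>f\<in>bloch \<alpha>. hilbert_op f \<in> log_bloch \<alpha>)
    \<and> (\<exists>K. \<forall>f\<in>bloch \<alpha>. log_bloch_norm \<alpha> (hilbert_op f) \<le> K * bloch_norm \<alpha> f)
    \<and> hilbert_op_norm \<alpha> =
        (if \<alpha> \<le> 4/3 then 3/2
         else C \<alpha> + sqrt pi * Gamma (2 - \<alpha>) / (4 * Gamma (5/2 - \<alpha>)))
    \<and> (\<alpha> = 4/3 \<longrightarrow> 3/2 = C \<alpha> + sqrt pi * Gamma (2 - \<alpha>) / (4 * Gamma (5/2 - \<alpha>)))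
    \<and> (\<alpha> < 4/3 \<longrightarrow> (\<forall>f. f \<in> norm_attaining \<alpha> \<longleftrightarrow>
          (\<exists>l. norm l = 1 \<and> (\<forall>z\<in>ball 0 1. f z = l))))
    \<and> (\<alpha> = 4/3 \<longrightarrow> (\<forall>f. f \<in> norm_attaining \<alpha> \<longleftrightarrow>
          (\<exists>l. \<exists>a::real. norm l = 1 \<and> 0 \<le> a \<and> a \<le> 1 \<and>
             (\<forall>z\<in>ball 0 1. f z = l * (of_real a + (1 - of_real a) * F \<alpha> z)))))
    \<and> (4/3 < \<alpha> \<longrightarrow> (\<forall>f. f \<in> norm_attaining \<alpha> \<longleftrightarrow>
          (\<exists>l. norm l = 1 \<and> (\<forall>z\<in>ball 0 1. f z = l * F \<alpha> z))))"
proof -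
  define N where "N = (if \<alpha> \<le> 4/3 then 3/2 else F_image_norm \<alpha>)"
  note main = norm_attaining_iff[OF assms N_def]
  note tot = F_image_norm_eq[OF assms(2), symmetric]
  have ext1: "extremal \<alpha> l 1 z = l" and ext0: "extremal \<alpha> l 0 z = l * F \<alpha> z" for l z
    by (simp_all add: extremal_def)
  have low: "a * (3/2) + (1 - a) * F_image_norm \<alpha> = N \<longleftrightarrow> a = 1" if "\<alpha> < 4/3" for a
  proof -
    have "a * (3/2) + (1 - a) * F_image_norm \<alpha> - N = (1 - a) * (F_image_norm \<alpha> - 3/2)"
      using that by (simp add: N_def field_simps)
    moreover have "F_image_norm \<alpha> < 3/2" using F_image_norm_strict_mono[of \<alpha> "4/3"] F_image_norm_four_thirds assms that by simp
    ultimately show ?thesis by (metis diff_self eq_iff_diff_eq_0 less_irrefl mult_eq_0_iff)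
  qed
  have high: "a * (3/2) + (1 - a) * F_image_norm \<alpha> = N \<longleftrightarrow> a = 0" if "4/3 < \<alpha>" for a
  proof -
    have "a * (3/2) + (1 - a) * F_image_norm \<alpha> - N = a * (3/2 - F_image_norm \<alpha>)"
      using that by (simp add: N_def algebra_simps)
    moreover have "3/2 < F_image_norm \<alpha>" using F_image_norm_strict_mono[of "4/3" \<alpha>] F_image_norm_four_thirds assms that by simp
    ultimately show ?thesis by (metis eq_iff_diff_eq_0 less_irrefl mult_eq_0_iff)
  qed
  have mid: "a * (3/2) + (1 - a) * F_image_norm \<alpha> = N" if "\<alpha> = 4/3" for a
  proof -
    have t: "F_image_norm \<alpha> = 3/2" unfolding that by (rule F_image_norm_four_thirds)
    have n: "N = 3/2" using that by (simp add: N_def)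
    show ?thesis unfolding t n by (simp add: field_simps)
  qed
  show ?thesis
  proof (intro conjI impI allI ballI)
    show "\<exists>K. \<forall>f\<in>bloch \<alpha>. log_bloch_norm \<alpha> (hilbert_op f) \<le> K * bloch_norm \<alpha> f" by (rule main)
    show "hilbert_op_norm \<alpha> = (if \<alpha> \<le> 4/3 then 3/2
         else C \<alpha> + sqrt pi * Gamma (2 - \<alpha>) / (4 * Gamma (5/2 - \<alpha>)))"
      unfolding main(1) tot by (simp add: N_def)
    show "3/2 = C \<alpha> + sqrt pi * Gamma (2 - \<alpha>) / (4 * Gamma (5/2 - \<alpha>))" if "\<alpha> = 4/3"
      unfolding tot by (simp only: that F_image_norm_four_thirds)
    show "f \<in> norm_attaining \<alpha> \<longleftrightarrow> (\<exists>l. norm l = 1 \<and> (\<forall>z\<in>ball 0 1. f z = l))" if "\<alpha> < 4/3" for f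
      unfolding main(3) low[OF that] using ext1 by fastforce
    show "f \<in> norm_attaining \<alpha> \<longleftrightarrow> (\<exists>l. norm l = 1 \<and> (\<forall>z\<in>ball 0 1. f z = l * F \<alpha> z))" if "4/3 < \<alpha>" for f
      unfolding main(3) high[OF that] using ext0 by fastforce
    show "f \<in> norm_attaining \<alpha> \<longleftrightarrow> (\<exists>l. \<exists>a::real. norm l = 1 \<and> 0 \<le> a \<and> a \<le> 1 \<and>
             (\<forall>z\<in>ball 0 1. f z = l * (of_real a + (1 - of_real a) * F \<alpha> z)))" if "\<alpha> = 4/3" for f
      unfolding main(3) extremal_def using mid[OF that] by simp
  qed (use hilbert_integrable[OF assms] hilbert_log_bloch[OF assms] in auto)
qed

end
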